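(* Let $F:S^1\times[0,T)\to\mathbb{R}^2$ be a Minkowskian curvature flow. Let $L_{\mathcal{Q}}(t)$ be the $\mathcal{Q}$-length of $F(\cdot,t)$, $A(t)$ the area it encloses, and $k(s,t)$ its Minkowskian curvature as a function of the $\mathcal{Q}$-arclength parameter $s$. Then $$\frac{dL_{\mathcal{Q}}}{dt}=-\int_{0}^{L_{\mathcal{Q}}(t)}k^{2}(s,t)\,ds\qquad\text{and}\qquad \frac{dA}{dt}=-2A(\mathcal{P}).$$
   Context: $[\cdot,\cdot]$ denotes the determinant of two vectors of $\mathbb{R}^2$; $e_r=(\cos\theta,\sin\theta)$, $e_\theta=(-\sin\theta,\cos\theta)$; a prime denotes $d/d\theta$. $\mathcal{P}\subset\mathbb{R}^2$ is a strictly convex set, symmetric with respect to the origin, whose boundary is a $C^\infty$ curve $p(\theta)=a(\theta)e_r+a'(\theta)e_\theta$, where $a$ is the support function of $\mathcal{P}$; so $p'=(a+a'')e_\theta$ and $[p,p']=a(a+a'')$. It is assumed that $a+a''>0$ for all $\theta$. $A(\mathcal{P})$ is the usual area of $\mathcal{P}$. The dual unit ball $\mathcal{Q}$ has boundary $q(\theta)=p'(\theta)/[p(\theta),p'(\theta)]=\frac{1}{a(\theta)}e_\theta$. The Minkowskian curvature flow is a (smooth) family of closed curves $F:S^1\times[0,T)\to\mathbb{R}^2$ with $$\frac{\partial F}{\partial u}(u,t)=v(u,t)\,q(\theta(u,t)),\qquad \frac{\partial F}{\partial t}(u,t)=-k(u,t)\,p(\theta(u,t)),\qquad F(u,0)=\gamma(u),$$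 where $\gamma$ is a simple closed curve (traversed counterclockwise), $v>0$, and $\theta(u,t)$ is such that the angle between the $x$-axis and $\partial F/\partial u$ at $(u,t)$ is $\theta(u,t)+\pi/2$. Here $ds=v\,du$ is the $\mathcal{Q}$-arclength element, $L_{\mathcal{Q}}(t)=\int v\,du$, the Minkowskian curvature is $k=[p,p']\,\frac{\partial\theta}{\partial s}$, and the area is $A(t)=\frac12\int[F,\partial F/\partial u]\,du$. *)

theory Defs
  imports "HOL-Complex_Analysis.Complex_Analysis"
begin

text \<open>
  \<open>Ck_on n f S\<close>: \<open>f\<close> is \<open>n\<close> times continuously differentiable on \<open>S\<close>, where derivatives at points
  of \<open>S\<close> are taken within \<open>S\<close>. It is used for \<open>S = UNIV\<close> and for \<open>S = UNIV \<times> {0..<T}\<close>; there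
  derivatives within \<open>S\<close> are unique, and at time \<open>0\<close> they are one-sided in the time variable.
\<close>
primrec Ck_on ::
  "nat \<Rightarrow> ('a::euclidean_space \<Rightarrow> 'b::real_normed_vector) \<Rightarrow> 'a set \<Rightarrow> bool" where
  "Ck_on 0 f S \<longleftrightarrow> continuous_on S f"
| "Ck_on (Suc n) f S \<longleftrightarrow>
     (\<exists>D. (\<forall>x\<in>S. (f has_derivative D x) (at x within S)) \<and> (\<forall>h. Ck_on n (\<lambda>x. D x h) S))"

definition smooth_on ::
  "('a::euclidean_space \<Rightarrow> 'b::real_normed_vector) \<Rightarrow> 'a set \<Rightarrow> bool" where
  "smooth_on f S \<longleftrightarrow> (\<forall>n. Ck_on n f S)"

definition bracket :: "real ^ 2 \<Rightarrow> real ^ 2 \<Rightarrow> real" where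
  "bracket x y = det (vector [x, y] :: real ^ 2 ^ 2)"

definition e_r :: "real \<Rightarrow> real ^ 2" where
  "e_r \<theta> = vector [cos \<theta>, sin \<theta>]"

definition e_th :: "real \<Rightarrow> real ^ 2" where
  "e_th \<theta> = vector [- sin \<theta>, cos \<theta>]"


subsection \<open>The unit ball and its dual\<close>

definition strictly_convex :: "'a::real_normed_vector set \<Rightarrow> bool" where
  "strictly_convex S \<longleftrightarrow> (\<forall>x\<in>S. \<forall>y\<in>S. x \<noteq> y \<longrightarrow> open_segment x y \<subseteq> interior S)"

definition support_function :: "(real ^ 2) set \<Rightarrow> real \<Rightarrow> real" where
  "support_function P \<theta> = Sup ((\<lambda>x. x \<bullet> e_r \<theta>) ` P)"

text \<open>The boundary of the ball with support function \<open>a\<close>, parametrised by the normal angle.\<close>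
definition p_curve :: "(real \<Rightarrow> real) \<Rightarrow> real \<Rightarrow> real ^ 2" where
  "p_curve a \<theta> = a \<theta> *\<^sub>R e_r \<theta> + deriv a \<theta> *\<^sub>R e_th \<theta>"

definition p_curve' :: "(real \<Rightarrow> real) \<Rightarrow> real \<Rightarrow> real ^ 2" where
  "p_curve' a \<theta> = vector_derivative (p_curve a) (at \<theta>)"

definition q_curve :: "(real \<Rightarrow> real) \<Rightarrow> real \<Rightarrow> real ^ 2" where
  "q_curve a \<theta> = (1 / bracket (p_curve a \<theta>) (p_curve' a \<theta>)) *\<^sub>R p_curve' a \<theta>"

definition smooth_unit_ball :: "(real ^ 2) set \<Rightarrow> (real \<Rightarrow> real) \<Rightarrow> bool" where
  "smooth_unit_ball P a \<longleftrightarrow>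
     compact P \<and> strictly_convex P \<and> uminus ` P = P \<and>
     a = support_function P \<and> smooth_on a UNIV \<and>
     frontier P = range (p_curve a) \<and>
     (\<forall>\<theta>. a \<theta> + deriv (deriv a) \<theta> > 0)"


subsection \<open>Curves and the flow\<close>

text \<open>
  Functions on the circle are functions on the real line with period \<open>2 * pi\<close>. A simple closed curve
  is traversed counterclockwise if it winds once, positively, around each point it encloses.
\<close>
definition circle_path :: "(real \<Rightarrow> real ^ 2) \<Rightarrow> real \<Rightarrow> complex" where
  "circle_path \<gamma> x = Complex (\<gamma> (2 * pi * x) $ 1) (\<gamma> (2 * pi * x) $ 2)"

definition simple_closed_ccw :: "(real \<Rightarrow> real ^ 2) \<Rightarrow> bool" where
  "simple_closed_ccw \<gamma> \<longleftrightarrow>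
     (\<forall>u. \<gamma> (u + 2 * pi) = \<gamma> u) \<and>
     simple_path (circle_path \<gamma>) \<and>
     (\<forall>z \<in> inside (path_image (circle_path \<gamma>)). winding_number (circle_path \<gamma>) z = 1)"

definition F_u :: "(real \<Rightarrow> real \<Rightarrow> real ^ 2) \<Rightarrow> real \<Rightarrow> real \<Rightarrow> real ^ 2" where
  "F_u F u t = vector_derivative (\<lambda>w. F w t) (at u)"

text \<open>The curvature \<open>[p, p'] d\<theta>/ds\<close>, where \<open>d/ds\<close> is \<open>1/v\<close> times \<open>d/du\<close>.\<close>
definition mink_curvature ::
  "(real \<Rightarrow> real) \<Rightarrow> (real \<Rightarrow> real \<Rightarrow> real) \<Rightarrow> (real \<Rightarrow> real \<Rightarrow> real) \<Rightarrow> real \<Rightarrow> real \<Rightarrow> real" where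
  "mink_curvature a v \<theta> u t =
     bracket (p_curve a (\<theta> u t)) (p_curve' a (\<theta> u t)) * (deriv (\<lambda>w. \<theta> w t) u / v u t)"

text \<open>
  The angle, with values modulo \<open>2 * pi\<close> on the circle, is represented by a smooth real-valued lift
  \<open>\<theta>\<close>; no value of \<open>\<theta> (u + 2 * pi) t - \<theta> u t\<close> is prescribed.
\<close>
definition mink_curvature_flow ::
  "(real \<Rightarrow> real) \<Rightarrow> (real \<Rightarrow> real ^ 2) \<Rightarrow> real \<Rightarrow> (real \<Rightarrow> real \<Rightarrow> real ^ 2) \<Rightarrow>
   (real \<Rightarrow> real \<Rightarrow> real) \<Rightarrow> (real \<Rightarrow> real \<Rightarrow> real) \<Rightarrow> bool" where
  "mink_curvature_flow a \<gamma> T F v \<theta> \<longleftrightarrow>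
     0 < T \<and>
     smooth_on (\<lambda>(u, t). F u t) (UNIV \<times> {0..<T}) \<and>
     smooth_on (\<lambda>(u, t). \<theta> u t) (UNIV \<times> {0..<T}) \<and>
     simple_closed_ccw \<gamma> \<and>
     (\<forall>u. F u 0 = \<gamma> u) \<and>
     (\<forall>u. \<forall>t\<in>{0..<T}.
        F (u + 2 * pi) t = F u t \<and>
        v u t > 0 \<and>
        F_u F u t = norm (F_u F u t) *\<^sub>R e_r (\<theta> u t + pi / 2) \<and>
        ((\<lambda>w. F w t) has_vector_derivative v u t *\<^sub>R q_curve a (\<theta> u t)) (at u) \<and>
        ((\<lambda>\<tau>. F u \<tau>) has_vector_derivative
           - mink_curvature a v \<theta> u t *\<^sub>R p_curve a (\<theta> u t)) (at t within {0..<T}))"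


subsection \<open>Length, area, and curvature in terms of arclength\<close>

definition Q_length :: "(real \<Rightarrow> real \<Rightarrow> real) \<Rightarrow> real \<Rightarrow> real" where
  "Q_length v t = integral {0..2 * pi} (\<lambda>u. v u t)"

definition enclosed_area :: "(real \<Rightarrow> real \<Rightarrow> real ^ 2) \<Rightarrow> real \<Rightarrow> real" where
  "enclosed_area F t = 1 / 2 * integral {0..2 * pi} (\<lambda>u. bracket (F u t) (F_u F u t))"

definition Q_arclength :: "(real \<Rightarrow> real \<Rightarrow> real) \<Rightarrow> real \<Rightarrow> real \<Rightarrow> real" where
  "Q_arclength v t u = integral {0..u} (\<lambda>w. v w t)"

text \<open>
  The curvature as a function of \<open>s\<close> in \<open>{0..Q_length v t}\<close>, obtained by inverting
  \<open>Q_arclength v t\<close>, which is strictly increasing on \<open>{0..2 * pi}\<close>.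
\<close>
definition mink_curvature_arc ::
  "(real \<Rightarrow> real) \<Rightarrow> (real \<Rightarrow> real \<Rightarrow> real) \<Rightarrow> (real \<Rightarrow> real \<Rightarrow> real) \<Rightarrow> real \<Rightarrow> real \<Rightarrow> real" where
  "mink_curvature_arc a v \<theta> s t =
     mink_curvature a v \<theta> (the_inv_into {0..2 * pi} (Q_arclength v t) s) t"

end

theory Submission
  imports Defs
begin

text \<open>
  \<^emph>\<open>Length.\<close> Since \<open>[p, q] = 1\<close>, the equation \<open>F\<^sub>u = v q\<close> gives \<open>v = [p, F\<^sub>u]\<close>. In the time derivative of
  this bracket the rotation of \<open>p\<close> contributes nothing, because \<open>p'\<close> is parallel to \<open>q\<close>; the other term is
  \<open>[p, F\<^sub>t\<^sub>u]\<close>, and differentiating \<open>[F\<^sub>t, p] = 0\<close> along the curve evaluates it as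
  \<open>- k [p, p'] \<theta>\<^sub>u = - k\<^sup>2 v\<close>. Integrating \<open>v\<^sub>t = - k\<^sup>2 v\<close> over the circle and passing to arclength yields
  the first formula.

  \<^emph>\<open>Area.\<close> Integration by parts over the closed curve turns the derivative of the area into the integral of
  \<open>[F\<^sub>t, F\<^sub>u] = - k v = - [p, p'](\<theta>) \<theta>\<^sub>u\<close>. By substitution this is minus the integral of the periodic
  function \<open>[p, p']\<close> over the interval swept by \<open>\<theta>\<close>. If that interval is one full turn, the integral is
  twice the area of the unit ball, by the change of variables \<open>(r, x) \<mapsto> r p(x)\<close> with Jacobian \<open>r [p, p']\<close>
  (lemma \<open>measure_unit_ball\<close>).

  \<^emph>\<open>One full turn.\<close> The increment of \<open>\<theta>\<close> around the curve is continuous in time and a multiple of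
  \<open>2 \<pi>\<close>, hence determined by the initial curve, where it equals \<open>2 \<pi>\<close> by Hopf's Umlaufsatz
  (lemma \<open>tangent_rotation\<close>). The Umlaufsatz is proved with a continuous angle for all secants of the
  curve. Reversing a secant changes its angle by a constant odd multiple of \<open>\<pi>\<close>, and reversing it twice
  moves it once around the curve; so the tangent turns by an odd multiple of \<open>2 \<pi>\<close>. At a lowest point all
  secants lie in a half-plane, which leaves only \<open>\<plusminus> 2 \<pi>\<close>, and the sign is positive if the curve passes the
  lowest point to the right. It does so if it winds positively around the points it encloses: otherwise
  a point just above the lowest point would have winding number \<open>-1\<close>.
\<close>

section \<open>The rotating frame and the bracket\<close>

lemma bracket_components: "bracket x y = x $ 1 * y $ 2 - x $ 2 * y $ 1"
  by (simp add: bracket_def det_2)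

lemma bounded_bilinear_bracket: "bounded_bilinear bracket"
proof -
  have "bilinear bracket"
    unfolding bilinear_def by (auto intro!: linearI simp: bracket_components algebra_simps)
  then show ?thesis by (simp add: bilinear_conv_bounded_bilinear)
qed

lemmas has_vector_derivative_bracket = bounded_bilinear.has_vector_derivative[OF bounded_bilinear_bracket]
lemmas continuous_on_bracket = bounded_bilinear.continuous_on[OF bounded_bilinear_bracket]

lemma e_r_axis: "e_r x = cos x *\<^sub>R axis 1 1 + sin x *\<^sub>R axis 2 1"
  by (simp add: e_r_def vec_eq_iff forall_2 axis_def)

lemma e_th_axis: "e_th x = (- sin x) *\<^sub>R axis 1 1 + cos x *\<^sub>R axis 2 1"
  by (simp add: e_th_def vec_eq_iff forall_2 axis_def)

lemma e_r_has_vector_derivative [derivative_intros]: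
  "(e_r has_vector_derivative e_th x) (at x within S)"
  unfolding e_r_axis e_th_axis by (auto intro!: derivative_eq_intros)

lemma e_th_has_vector_derivative [derivative_intros]:
  "(e_th has_vector_derivative - e_r x) (at x within S)"
  unfolding e_r_axis e_th_axis by (auto intro!: derivative_eq_intros)

lemma bracket_self [simp]: "bracket x x = 0" by (simp add: bracket_components)

lemma bracket_frame [simp]:
  "bracket (e_r x) (e_th x) = 1" "bracket (e_th x) (e_r x) = -1"
proof -
  show *: "bracket (e_r x) (e_th x) = 1"
    by (simp add: bracket_components e_r_def e_th_def flip: power2_eq_square)
  show "bracket (e_th x) (e_r x) = -1"
    using * by (simp add: bracket_components algebra_simps)
qed

lemmas bracket_linear =
  bounded_bilinear.add_left[OF bounded_bilinear_bracket]
  bounded_bilinear.add_right[OF bounded_bilinear_bracket]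
  bounded_bilinear.minus_left[OF bounded_bilinear_bracket]
  bounded_bilinear.minus_right[OF bounded_bilinear_bracket]
  bounded_bilinear.scaleR_left[OF bounded_bilinear_bracket]
  bounded_bilinear.scaleR_right[OF bounded_bilinear_bracket]
  bounded_bilinear.zero_left[OF bounded_bilinear_bracket]
  bounded_bilinear.zero_right[OF bounded_bilinear_bracket]

lemma bracket_swap: "bracket y x = - bracket x y" by (simp add: bracket_components)

section \<open>Calculus of smooth families\<close>

lemma Ck_on_Suc_real:
  fixes f :: "real \<Rightarrow> real"
  assumes "Ck_on (Suc n) f UNIV"
  shows "\<And>x. (f has_real_derivative deriv f x) (at x)" "Ck_on n (deriv f) UNIV"
proof -
  from assms obtain D where D: "\<And>x. (f has_derivative D x) (at x)" and C: "\<And>h. Ck_on n (\<lambda>x. D x h) UNIV"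
    by auto
  have *: "(f has_real_derivative D x 1) (at x)" for x
  proof -
    have "D x = (*) (D x 1)"
      using D[of x]
      by (metis (no_types, opaque_lifting) ext has_derivative_linear linear_scale mult.commute mult_1_right real_scaleR_def)
    then show ?thesis using D[of x] by (simp add: has_field_derivative_def)
  qed
  then have **: "deriv f = (\<lambda>x. D x 1)" by (auto intro: DERIV_imp_deriv)
  show "\<And>x. (f has_real_derivative deriv f x) (at x)" "Ck_on n (deriv f) UNIV"
    using * C unfolding ** by auto
qed

lemma Ck_on_imp_continuous_on: "Ck_on n f S \<Longrightarrow> continuous_on S f"
  by (cases n) (auto simp: continuous_on_eq_continuous_within dest: has_derivative_continuous)

text \<open>
  The derivative within the strip restricts to horizontal and vertical slices; at the lower end of the
  time interval the second restriction is a one-sided derivative.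
\<close>
lemma Ck_on_Suc_partials:
  fixes f :: "real \<Rightarrow> real \<Rightarrow> 'b::real_normed_vector"
  assumes "Ck_on (Suc n) (\<lambda>(u, t). f u t) (UNIV \<times> I)"
  obtains fu ft where
    "\<And>u t. t \<in> I \<Longrightarrow> ((\<lambda>w. f w t) has_vector_derivative fu u t) (at u)"
    "\<And>u t. t \<in> I \<Longrightarrow> ((\<lambda>\<tau>. f u \<tau>) has_vector_derivative ft u t) (at t within I)"
    "Ck_on n (\<lambda>(u, t). fu u t) (UNIV \<times> I)" "Ck_on n (\<lambda>(u, t). ft u t) (UNIV \<times> I)"
proof -
  let ?S = "UNIV \<times> I" and ?f = "\<lambda>(u, t). f u t"
  obtain D where D: "\<And>x. x \<in> ?S \<Longrightarrow> (?f has_derivative D x) (at x within ?S)"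
    and Ck: "\<And>h. Ck_on n (\<lambda>x. D x h) ?S" using assms by auto
  show thesis
  proof
    fix u t assume t: "t \<in> I"
    then have D_ut: "(?f has_derivative D (u, t)) (at (u, t) within ?S)" by (intro D) auto
    have lin: "D (u, t) (h *\<^sub>R z) = h *\<^sub>R D (u, t) z" for h z
      using has_derivative_linear[OF D_ut] by (rule linear_scale)
    have "((\<lambda>w. (w, t)) has_derivative (\<lambda>h. (h, 0))) (at u)"
      by (auto intro!: derivative_eq_intros)
    moreover have "(?f has_derivative D (u, t)) (at (u, t) within range (\<lambda>w. (w, t)))"
      by (rule has_derivative_subset[OF D_ut]) (use t in auto)
    ultimately have "((\<lambda>w. ?f (w, t)) has_derivative (\<lambda>h. D (u, t) (h, 0))) (at u)"
      by (rule has_derivative_in_compose)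
    moreover have "(\<lambda>h. D (u, t) (h, 0)) = (\<lambda>h. h *\<^sub>R D (u, t) (1, 0))"
      by (rule ext, subst lin[symmetric]) simp
    ultimately show "((\<lambda>w. f w t) has_vector_derivative D (u, t) (1, 0)) (at u)"
      by (simp only: has_vector_derivative_def prod.case)
    have "((\<lambda>\<tau>. (u, \<tau>)) has_derivative (\<lambda>h. (0, h))) (at t within I)"
      by (auto intro!: derivative_eq_intros)
    moreover have "(?f has_derivative D (u, t)) (at (u, t) within (\<lambda>\<tau>. (u, \<tau>)) ` I)"
      by (rule has_derivative_subset[OF D_ut]) auto
    ultimately have "((\<lambda>\<tau>. ?f (u, \<tau>)) has_derivative (\<lambda>h. D (u, t) (0, h))) (at t within I)"
      by (rule has_derivative_in_compose)
    moreover have "(\<lambda>h. D (u, t) (0, h)) = (\<lambda>h. h *\<^sub>R D (u, t) (0, 1))"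
      by (rule ext, subst lin[symmetric]) simp
    ultimately show "((\<lambda>\<tau>. f u \<tau>) has_vector_derivative D (u, t) (0, 1)) (at t within I)"
      by (simp only: has_vector_derivative_def prod.case)
  next
    have *: "(\<lambda>(u, t). D (u, t) h) = (\<lambda>x. D x h)" for h by auto
    show "Ck_on n (\<lambda>(u, t). D (u, t) (1, 0)) ?S" "Ck_on n (\<lambda>(u, t). D (u, t) (0, 1)) ?S"
      unfolding * by (rule Ck)+
  qed
qed

text \<open>
  At the initial time only a one-sided time derivative exists, so the two derivatives are exchanged by way
  of integrals: \<open>f\<close> is its initial value plus the time integral of \<open>ft\<close>, differentiation in space passes
  under the integral, and the result is differentiated with respect to the upper limit.
\<close>
lemma mixed_partials:
  fixes f fu ft ftu :: "real \<Rightarrow> real \<Rightarrow> 'b::euclidean_space"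
  assumes fu: "\<And>u t. t \<in> {0..<T} \<Longrightarrow> ((\<lambda>w. f w t) has_vector_derivative fu u t) (at u)"
    and ft: "\<And>u t. t \<in> {0..<T} \<Longrightarrow> ((\<lambda>\<tau>. f u \<tau>) has_vector_derivative ft u t) (at t within {0..<T})"
    and ftu: "\<And>u t. t \<in> {0..<T} \<Longrightarrow> ((\<lambda>w. ft w t) has_vector_derivative ftu u t) (at u)"
    and ft_cont: "continuous_on (UNIV \<times> {0..<T}) (\<lambda>(u, t). ft u t)"
    and ftu_cont: "continuous_on (UNIV \<times> {0..<T}) (\<lambda>(u, t). ftu u t)"
    and t: "t \<in> {0..<T}"
  shows "((\<lambda>\<tau>. fu u \<tau>) has_vector_derivative ftu u t) (at t within {0..<T})"
proof -
  have slice: "continuous_on J (\<lambda>\<tau>. g w \<tau>)" if "continuous_on (UNIV \<times> {0..<T}) (\<lambda>(u, t). g u t)" "J \<subseteq> {0..<T}"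
    for g :: "real \<Rightarrow> real \<Rightarrow> 'b" and w J
  proof -
    have "continuous_on J (\<lambda>\<tau>. (\<lambda>(u, t). g u t) (w, \<tau>))"
      by (rule continuous_on_compose2[OF that(1)]) (use that(2) in \<open>auto intro!: continuous_intros\<close>)
    then show ?thesis by simp
  qed
  have f_eq: "f w \<tau> = f w 0 + integral (cbox 0 \<tau>) (\<lambda>\<sigma>. ft w \<sigma>)" if "\<tau> \<in> {0..<T}" for w \<tau>
  proof -
    have "((\<lambda>\<sigma>. ft w \<sigma>) has_integral f w \<tau> - f w 0) {0..\<tau>}"
    proof (rule fundamental_theorem_of_calculus)
      fix \<sigma> assume "\<sigma> \<in> {0..\<tau>}"
      then show "((\<lambda>\<sigma>. f w \<sigma>) has_vector_derivative ft w \<sigma>) (at \<sigma> within {0..\<tau>})"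
        using that by (intro has_vector_derivative_within_subset[OF ft]) auto
    qed (use that in auto)
    then show ?thesis by (simp add: integral_unique)
  qed
  have fu_eq: "fu u \<tau> = fu u 0 + integral {0..\<tau>} (\<lambda>\<sigma>. ftu u \<sigma>)" if \<tau>: "\<tau> \<in> {0..<T}" for \<tau>
  proof -
    have "((\<lambda>w. integral (cbox 0 \<tau>) (ft w)) has_vector_derivative integral (cbox 0 \<tau>) (ftu u)) (at u within UNIV)"
    proof (rule leibniz_rule_vector_derivative)
      show "ft w integrable_on cbox 0 \<tau>" for w
        by (intro integrable_continuous slice[OF ft_cont]) (use \<tau> in auto)
      show "continuous_on (UNIV \<times> cbox 0 \<tau>) (\<lambda>(w, t). ftu w t)"
        by (rule continuous_on_subset[OF ftu_cont]) (use \<tau> in auto)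
    qed (use ftu \<tau> in auto)
    then have "((\<lambda>w. f w 0 + integral (cbox 0 \<tau>) (ft w)) has_vector_derivative fu u 0 + integral (cbox 0 \<tau>) (ftu u)) (at u)"
      using \<tau> by (intro has_vector_derivative_add fu) auto
    then have "((\<lambda>w. f w \<tau>) has_vector_derivative fu u 0 + integral (cbox 0 \<tau>) (ftu u)) (at u)"
      using f_eq[OF \<tau>] by simp
    then show ?thesis using fu[OF \<tau>, of u] vector_derivative_unique_at by fastforce
  qed
  define b where "b = (t + T) / 2"
  have b: "t < b" "b < T" using t by (auto simp: b_def field_simps)
  have "((\<lambda>\<tau>. integral {0..\<tau>} (ftu u)) has_vector_derivative ftu u t) (at t within {0..b})"
    by (intro integral_has_vector_derivative slice[OF ftu_cont]) (use b t in auto)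
  then have "((\<lambda>\<tau>. fu u 0 + integral {0..\<tau>} (ftu u)) has_vector_derivative ftu u t) (at t within {0..b})"
    by (auto intro!: derivative_eq_intros)
  then have "((\<lambda>\<tau>. fu u \<tau>) has_vector_derivative ftu u t) (at t within {0..b})"
  proof (rule has_vector_derivative_transform[rotated 2])
    show "fu u \<tau> = fu u 0 + integral {0..\<tau>} (ftu u)" if "\<tau> \<in> {0..b}" for \<tau>
      using that b by (intro fu_eq) simp
  qed (use b t in simp)
  moreover have "at t within {0..b} = at t within {0..<T}"
    by (rule at_within_nhd[of t "{..<b}"]) (use b in auto)
  ultimately show ?thesis by simp
qed

text \<open>
  An antiderivative of a periodic function gains the same amount over every period, wherever the period
  starts; so only the total increment of \<open>\<theta>\<close> matters, and \<open>\<theta>\<close> may run back and forth in between.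
\<close>
lemma integral_along_circle_map:
  fixes w \<theta> \<theta>' :: "real \<Rightarrow> real"
  assumes w: "continuous_on UNIV w" "\<And>x. w (x + 2 * pi) = w x"
    and \<theta>: "\<And>u. (\<theta> has_real_derivative \<theta>' u) (at u)"
    and turn: "\<theta> (2 * pi) = \<theta> 0 + 2 * pi"
  shows "((\<lambda>u. w (\<theta> u) * \<theta>' u) has_integral integral {0..2 * pi} w) {0..2 * pi}"
proof -
  have "\<exists>W. \<forall>x::real. - \<infinity> < ereal x \<longrightarrow> ereal x < \<infinity> \<longrightarrow> (W has_vector_derivative w x) (at x)"
    using w(1) by (intro einterval_antiderivative) (auto simp: continuous_on_eq_continuous_at)
  then obtain W where W: "\<And>x. (W has_real_derivative w x) (at x)"
    by (auto simp: has_real_derivative_iff_has_vector_derivative)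
  have "((\<lambda>u. w (\<theta> u) * \<theta>' u) has_integral W (\<theta> (2 * pi)) - W (\<theta> 0)) {0..2 * pi}"
    by (rule fundamental_theorem_of_calculus)
       (auto intro!: DERIV_chain2[OF W] has_field_derivative_at_within[OF \<theta>] simp flip: has_real_derivative_iff_has_vector_derivative)
  moreover have "W (\<theta> 0 + 2 * pi) - W (\<theta> 0) = W (0 + 2 * pi) - W 0"
  proof -
    have "\<forall>x. DERIV (\<lambda>x. W (x + 2 * pi) - W x) x :> 0"
    proof
      fix x
      have "((\<lambda>x. W (x + 2 * pi) - W x) has_real_derivative w (x + 2 * pi) - w x) (at x)"
        by (rule DERIV_diff[OF iffD1[OF DERIV_shift W] W])
      then show "((\<lambda>x. W (x + 2 * pi) - W x) has_real_derivative 0) (at x)" by (simp add: w(2))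
    qed
    from DERIV_isconst_all[OF this, of "\<theta> 0" 0] show ?thesis by simp
  qed
  moreover have "integral {0..2 * pi} w = W (2 * pi) - W 0"
    by (intro integral_unique fundamental_theorem_of_calculus)
       (auto intro!: has_field_derivative_at_within[OF W] simp flip: has_real_derivative_iff_has_vector_derivative)
  ultimately show ?thesis by (simp only: turn add_0)
qed

text \<open>
  Because the density \<open>v\<close> is positive, the arclength has a continuous inverse; the identity is then the
  substitution rule.
\<close>
lemma integral_arclength_reparametrization:
  fixes v g :: "real \<Rightarrow> real" and b :: real
  defines "s \<equiv> \<lambda>u. integral {0..u} v"
  assumes "0 \<le> b" and v: "continuous_on {0..b} v" "\<And>u. u \<in> {0..b} \<Longrightarrow> v u > 0"
    and g: "continuous_on {0..b} g"
  shows "integral {0..s b} (\<lambda>x. g (the_inv_into {0..b} s x)) = integral {0..b} (\<lambda>u. v u * g u)"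
proof -
  have s_deriv: "(s has_real_derivative v u) (at u within {0..b})" if "u \<in> {0..b}" for u
    unfolding s_def using integral_has_vector_derivative[OF v(1) that]
    by (simp add: has_real_derivative_iff_has_vector_derivative)
  have s_cont: "continuous_on {0..b} s" by (rule DERIV_continuous_on[OF s_deriv])
  have s_mono: "s x < s y" if "0 \<le> x" "x < y" "y \<le> b" for x y
  proof (rule DERIV_pos_imp_increasing_open[OF that(2)])
    fix z assume "x < z" "z < y"
    then have "at z within {0..b} = at z" using that by (intro at_within_interior) (auto simp: interior_atLeastAtMost_real)
    then show "\<exists>D. (s has_real_derivative D) (at z) \<and> 0 < D"
      using s_deriv[of z] v(2)[of z] \<open>x < z\<close> \<open>z < y\<close> that by auto
  qed (rule continuous_on_subset[OF s_cont], use that in auto)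
  then have inj: "inj_on s {0..b}" by (auto simp: inj_on_def) (metis linorder_neqE less_irrefl)
  have s0: "s 0 = 0" by (simp add: s_def)
  have image: "s ` {0..b} = {0..s b}"
  proof
    show "s ` {0..b} \<subseteq> {0..s b}"
    proof
      fix y assume "y \<in> s ` {0..b}"
      then obtain x where x: "0 \<le> x" "x \<le> b" "y = s x" by auto
      then show "y \<in> {0..s b}"
        using s_mono[of 0 x] s_mono[of x b] s0 by (cases "x = 0"; cases "x = b") auto
    qed
    show "{0..s b} \<subseteq> s ` {0..b}"
    proof
      fix y assume "y \<in> {0..s b}"
      then obtain x where "0 \<le> x" "x \<le> b" "s x = y"
        using IVT'[of s 0 y b] s0 s_cont \<open>0 \<le> b\<close> by auto
      then show "y \<in> s ` {0..b}" by auto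
    qed
  qed
  let ?h = "\<lambda>x. g (the_inv_into {0..b} s x)"
  have "continuous_on {0..s b} (the_inv_into {0..b} s)"
    using continuous_on_inv_into[OF s_cont compact_Icc inj] image by simp
  then have h: "continuous_on {0..s b} ?h"
    by (rule continuous_on_compose2[OF g]) (use the_inv_into_into[OF inj _ order_refl] image in auto)
  have "((\<lambda>u. v u *\<^sub>R ?h (s u)) has_integral integral {s 0..s b} ?h) {0..b}"
    using image s0 \<open>0 \<le> b\<close> s_deriv h by (intro has_integral_substitution[where c = 0 and d = "s b"]) auto
  then have "integral {0..b} (\<lambda>u. v u *\<^sub>R ?h (s u)) = integral {0..s b} ?h"
    by (simp add: s0 integral_unique)
  moreover have "integral {0..b} (\<lambda>u. v u *\<^sub>R ?h (s u)) = integral {0..b} (\<lambda>u. v u * g u)"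
    by (rule integral_cong) (simp add: the_inv_into_f_f[OF inj])
  ultimately show ?thesis by simp
qed

section \<open>The unit ball and its area\<close>

locale unit_ball =
  fixes P :: "(real ^ 2) set" and a :: "real \<Rightarrow> real"
  assumes ball: "smooth_unit_ball P a"
begin

lemma a_deriv: "(a has_real_derivative deriv a x) (at x)"
  and a_deriv2: "(deriv a has_real_derivative deriv (deriv a) x) (at x)"
  and a_cont2: "continuous_on UNIV (deriv (deriv a))"
proof -
  have "Ck_on (Suc (Suc 0)) a UNIV" using ball by (auto simp: smooth_unit_ball_def smooth_on_def simp del: Ck_on.simps)
  note * = Ck_on_Suc_real[OF this]
  note ** = Ck_on_Suc_real[OF *(2)]
  show "(a has_real_derivative deriv a x) (at x)" "(deriv a has_real_derivative deriv (deriv a) x) (at x)"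
    "continuous_on UNIV (deriv (deriv a))" using * ** by auto
qed

lemma a_cont: "continuous_on UNIV a"
  using a_deriv by (meson DERIV_isCont continuous_at_imp_continuous_on)

lemma p_has_vector_derivative:
  "(p_curve a has_vector_derivative (a x + deriv (deriv a) x) *\<^sub>R e_th x) (at x within S)"
proof -
  have "(p_curve a has_vector_derivative
      (a x *\<^sub>R e_th x + deriv a x *\<^sub>R e_r x) + (deriv a x *\<^sub>R (- e_r x) + deriv (deriv a) x *\<^sub>R e_th x)) (at x within S)"
    unfolding p_curve_def[abs_def]
    by (intro has_vector_derivative_add has_vector_derivative_scaleR e_r_has_vector_derivative
         e_th_has_vector_derivative has_field_derivative_at_within[OF a_deriv] has_field_derivative_at_within[OF a_deriv2])
  then show ?thesis by (simp add: scaleR_add_left)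
qed

lemma p_curve'_eq: "p_curve' a x = (a x + deriv (deriv a) x) *\<^sub>R e_th x"
  unfolding p_curve'_def by (rule vector_derivative_at[OF p_has_vector_derivative])

lemma bracket_p_p': "bracket (p_curve a x) (p_curve' a x) = a x * (a x + deriv (deriv a) x)"
  by (simp add: p_curve'_eq p_curve_def bracket_linear)

lemma p_cont: "continuous_on S (p_curve a)"
  using p_has_vector_derivative by (meson has_vector_derivative_continuous continuous_on_eq_continuous_within)

lemma p_frontier: "frontier P = range (p_curve a)"
  and P_compact: "compact P" and P_sym: "uminus ` P = P"
  and a_sup: "a = support_function P"
  and a_convexity: "a x + deriv (deriv a) x > 0"
  using ball by (auto simp: smooth_unit_ball_def)

lemma open_segment_interior:
  assumes "x \<in> P" "y \<in> P" "x \<noteq> y"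
  shows "open_segment x y \<subseteq> interior P"
  using ball assms by (simp add: smooth_unit_ball_def strictly_convex_def)

lemma P_convex: "convex P"
  unfolding convex_contains_open_segment
  using open_segment_interior interior_subset open_segment_idem by (metis empty_subsetI subset_trans)

lemma p_in_P: "p_curve a x \<in> P"
  using p_frontier P_compact frontier_subset_closed compact_imp_closed by blast

text \<open>
  The origin is the midpoint of the segment from a nonzero point \<open>x\<close> of the ball to \<open>- x\<close>, so strict convexity
  makes it interior. The degenerate ball that contains only the origin has \<open>a = 0\<close>, which contradicts
  \<open>a + a'' > 0\<close>.
\<close>
lemma zero_interior: "0 \<in> interior P"
proof (cases "P = {0}")
  case True
  then have "a = (\<lambda>x. 0)" unfolding a_sup by (auto simp: support_function_def)
  then have "deriv a = (\<lambda>x. 0)" by auto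
  then show ?thesis using a_convexity[of 0] \<open>a = _\<close> by simp
next
  case False
  then obtain x where x: "x \<in> P" "x \<noteq> 0" using p_in_P[of 0] by (cases "p_curve a 0 = 0") auto
  have "- x \<in> P" using x P_sym by blast
  moreover have "x \<noteq> - x" using x by (auto simp: vec_eq_iff)
  ultimately have "open_segment x (-x) \<subseteq> interior P"
    using x by (intro open_segment_interior) auto
  moreover have "0 \<in> open_segment x (-x)"
    using \<open>x \<noteq> -x\<close> by (auto simp: in_segment intro!: exI[of _ "1/2"])
  ultimately show ?thesis by blast
qed

lemma inner_le_a: "x \<in> P \<Longrightarrow> x \<bullet> e_r y \<le> a y"
proof -
  assume x: "x \<in> P"
  have "bounded ((\<lambda>x. x \<bullet> e_r y) ` P)"
    using P_compact by (intro compact_imp_bounded compact_continuous_image continuous_intros)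
  then show ?thesis unfolding a_sup support_function_def
    using x by (intro cSup_upper) (auto simp: bounded_imp_bdd_above)
qed

lemma norm_e_r [simp]: "norm (e_r y) = 1"
  by (simp add: norm_vec_def L2_set_def sum_2 e_r_def)

lemma a_pos: "a y > 0"
proof -
  obtain e where e: "e > 0" "cball 0 e \<subseteq> P" using zero_interior by (auto simp: mem_interior_cball)
  then have "e *\<^sub>R e_r y \<in> P" by (auto simp: subset_iff)
  then have "(e *\<^sub>R e_r y) \<bullet> e_r y \<le> a y" by (rule inner_le_a)
  then show ?thesis using e by (simp add: dot_square_norm)
qed

lemma a_periodic: "a (x + 2 * pi) = a x"
  unfolding a_sup support_function_def by (simp add: e_r_def)

lemma deriv_a_periodic: "deriv a (x + 2 * pi) = deriv a x"
proof -
  have "((\<lambda>x. a (x + 2 * pi)) has_real_derivative deriv a (x + 2 * pi)) (at x)"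
    using DERIV_shift a_deriv by blast
  then have "(a has_real_derivative deriv a (x + 2 * pi)) (at x)" by (simp add: a_periodic)
  then show ?thesis by (simp add: DERIV_imp_deriv)
qed

lemma deriv2_a_periodic: "deriv (deriv a) (x + 2 * pi) = deriv (deriv a) x"
proof -
  have "((\<lambda>x. deriv a (x + 2 * pi)) has_real_derivative deriv (deriv a) (x + 2 * pi)) (at x)"
    using DERIV_shift a_deriv2 by blast
  then have "(deriv a has_real_derivative deriv (deriv a) (x + 2 * pi)) (at x)" by (simp add: deriv_a_periodic)
  then show ?thesis by (simp add: DERIV_imp_deriv)
qed

lemma p_periodic: "p_curve a (x + 2 * pi) = p_curve a x"
  by (simp add: p_curve_def a_periodic deriv_a_periodic e_r_def e_th_def)

lemma p_periodic_int: "p_curve a (x + 2 * pi * of_int n) = p_curve a x"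
proof -
  interpret periodic_fun_simple "p_curve a" "2 * pi" by unfold_locales (rule p_periodic)
  show ?thesis using plus_of_int[of x n] by (simp add: mult.commute)
qed

lemma q_curve_eq: "q_curve a x = (1 / a x) *\<^sub>R e_th x"
  using a_convexity[of x] by (simp add: q_curve_def bracket_p_p'[unfolded p_curve'_eq] p_curve'_eq)

end

text \<open>
  The change of variables formula concerns vectors and Fubini's theorem concerns pairs; the two planes
  are identified here by a map that preserves boxes and their volume.
\<close>
lemma has_integral_vec2:
  fixes f :: "real \<times> real \<Rightarrow> real"
  assumes f: "continuous_on (cbox (a, c) (b, d)) f"
  shows "((\<lambda>x :: real ^ 2. f (x $ 1, x $ 2)) has_integral
           integral {a..b} (\<lambda>x. integral {c..d} (\<lambda>y. f (x, y)))) (cbox (vector [a, c]) (vector [b, d]))"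
proof -
  let ?g = "\<lambda>x :: real ^ 2. (x $ 1, x $ 2)" and ?h = "\<lambda>z :: real \<times> real. vector [fst z, snd z] :: real ^ 2"
  have g: "?g ` cbox u w = cbox (u $ 1, u $ 2) (w $ 1, w $ 2)" for u w
  proof (intro set_eqI iffI)
    fix z assume "z \<in> cbox (u $ 1, u $ 2) (w $ 1, w $ 2)"
    then show "z \<in> ?g ` cbox u w"
      by (intro image_eqI[of _ _ "?h z"]) (auto simp: mem_box_cart forall_2 cbox_Pair_eq)
  qed (auto simp: mem_box_cart cbox_Pair_eq)
  have h: "?h ` cbox u w = cbox (?h u) (?h w)" for u w
  proof (intro set_eqI iffI)
    fix z assume "z \<in> cbox (?h u) (?h w)"
    then show "z \<in> ?h ` cbox u w"
      by (intro image_eqI[of _ _ "?g z"])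
         (cases u; cases w; auto simp: mem_box_cart forall_2 vec_eq_iff cbox_Pair_eq)+
  qed (cases u; cases w; auto simp: mem_box_cart forall_2 cbox_Pair_eq)
  have content: "measure lborel (?g ` cbox u w) = 1 * measure lborel (cbox u w)" for u w
    using interval_ne_empty_cart(1)[of u w]
    by (auto simp: g content_Pair content_cbox_if_cart content_real_if forall_2 UNIV_2)
  have int: "(f has_integral integral {a..b} (\<lambda>x. integral {c..d} (\<lambda>y. f (x, y)))) (cbox (a, c) (b, d))"
    using integral_prod_continuous[OF f] integrable_continuous[OF f] by (simp add: has_integral_integral)
  have cont: "continuous (at x) ?g" for x by (intro continuous_intros)
  have hg: "?h (?g x) = x" for x by (simp add: vec_eq_iff forall_2)
  have gh: "?g (?h x) = x" for x by simp
  have "((\<lambda>x. f (?g x)) has_integral (1 / 1) *\<^sub>R integral {a..b} (\<lambda>x. integral {c..d} (\<lambda>y. f (x, y))))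
          (?h ` cbox (a, c) (b, d))"
    by (rule has_integral_twiddle[OF _ hg gh cont _ _ content int]) (use g h in auto)
  then show ?thesis unfolding h by simp
qed

context unit_ball
begin

text \<open>
  A continuous choice of the polar angle of \<open>p_curve a x\<close>: the normal angle \<open>x\<close>, corrected by the angle
  from \<open>e_r x\<close> to \<open>p_curve a x\<close>, which stays below a right angle because \<open>a > 0\<close>.
\<close>
definition polar_angle :: "real \<Rightarrow> real" where
  "polar_angle x = x + arctan (deriv a x / a x)"

lemma p_polar: "p_curve a x = sqrt ((a x)\<^sup>2 + (deriv a x)\<^sup>2) *\<^sub>R e_r (polar_angle x)"
proof -
  let ?y = "deriv a x / a x"
  have s: "sqrt (1 + ?y\<^sup>2) = sqrt ((a x)\<^sup>2 + (deriv a x)\<^sup>2) / a x"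
  proof -
    have "1 + ?y\<^sup>2 = ((a x)\<^sup>2 + (deriv a x)\<^sup>2) / (a x)\<^sup>2"
      using a_pos[of x] by (simp add: field_simps power2_eq_square)
    then show ?thesis using a_pos[of x] by (simp add: real_sqrt_divide)
  qed
  have pos: "sqrt ((a x)\<^sup>2 + (deriv a x)\<^sup>2) > 0"
    using a_pos[of x] by (simp add: add_pos_nonneg)
  have "sqrt ((a x)\<^sup>2 + (deriv a x)\<^sup>2) * cos (arctan ?y) = a x"
    "sqrt ((a x)\<^sup>2 + (deriv a x)\<^sup>2) * sin (arctan ?y) = deriv a x"
    using pos a_pos[of x] by (simp_all add: cos_arctan sin_arctan s)
  then have "a x = sqrt ((a x)\<^sup>2 + (deriv a x)\<^sup>2) * cos (arctan ?y)"
    "deriv a x = sqrt ((a x)\<^sup>2 + (deriv a x)\<^sup>2) * sin (arctan ?y)" by simp_all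
  moreover define l where "l = sqrt ((a x)\<^sup>2 + (deriv a x)\<^sup>2)"
  moreover define \<alpha> where "\<alpha> = arctan ?y"
  ultimately have "p_curve a x = l *\<^sub>R (cos \<alpha> *\<^sub>R e_r x + sin \<alpha> *\<^sub>R e_th x)"
    by (simp add: p_curve_def scaleR_add_right)
  also have "cos \<alpha> *\<^sub>R e_r x + sin \<alpha> *\<^sub>R e_th x = e_r (x + \<alpha>)"
    by (simp add: e_r_def e_th_def vec_eq_iff forall_2 cos_add sin_add)
  finally show ?thesis by (simp add: l_def \<alpha>_def polar_angle_def)
qed

text \<open>
  The derivative is \<open>[p, p'] / \<bar>p\<bar>\<^sup>2\<close>, which is positive.
\<close>
lemma polar_angle_strict_mono: "strict_mono polar_angle"
proof (rule strict_monoI)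
  fix x y :: real assume "x < y"
  then show "polar_angle x < polar_angle y"
  proof (rule DERIV_pos_imp_increasing)
    fix z
    let ?D = "a z * (a z + deriv (deriv a) z) / ((a z)\<^sup>2 + (deriv a z)\<^sup>2)"
    have nz: "a z \<noteq> 0" "(a z)\<^sup>2 + (deriv a z)\<^sup>2 > 0" "1 + (deriv a z / a z)\<^sup>2 > 0"
      using a_pos[of z] by (auto simp: add_pos_nonneg)
    have "((\<lambda>x. deriv a x / a x) has_real_derivative
        (deriv (deriv a) z * a z - deriv a z * deriv a z) / (a z * a z)) (at z)"
      by (rule DERIV_divide[OF a_deriv2 a_deriv nz(1)])
    from DERIV_add[OF DERIV_ident DERIV_chain2[OF DERIV_arctan this]]
    have "(polar_angle has_real_derivative
        1 + inverse (1 + (deriv a z / a z)\<^sup>2) * ((deriv (deriv a) z * a z - deriv a z * deriv a z) / (a z * a z))) (at z)"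
      unfolding polar_angle_def[abs_def] .
    also have "inverse (1 + (deriv a z / a z)\<^sup>2) * ((deriv (deriv a) z * a z - deriv a z * deriv a z) / (a z * a z))
       = (deriv (deriv a) z * a z - deriv a z * deriv a z) / (a z * a z) / (1 + (deriv a z / a z)\<^sup>2)"
      by (simp add: divide_inverse)
    also have "1 + (deriv (deriv a) z * a z - deriv a z * deriv a z) / (a z * a z) / (1 + (deriv a z / a z)\<^sup>2) = ?D"
    proof -
      have e: "(a z * a z) * (1 + (deriv a z / a z)\<^sup>2) = (a z)\<^sup>2 + (deriv a z)\<^sup>2"
        using nz by (simp add: field_simps power2_eq_square)
      show ?thesis unfolding divide_divide_eq_left e using nz
        by (simp add: field_simps power2_eq_square)
    qed
    finally show "\<exists>D. (polar_angle has_real_derivative D) (at z) \<and> 0 < D"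
      using a_pos[of z] a_convexity[of z] nz by (intro exI[of _ ?D]) auto
  qed
qed

lemma polar_angle_shift: "polar_angle (x + 2 * pi) = polar_angle x + 2 * pi"
  by (simp add: polar_angle_def a_periodic deriv_a_periodic)

text \<open>
  The boundary cannot meet a ray from the origin twice, because its polar angle increases strictly and gains exactly
  \<open>2 \<pi>\<close> per period.
\<close>
lemma same_ray_imp_eq:
  assumes "r *\<^sub>R p_curve a x = s *\<^sub>R p_curve a y" "r > 0" "s > 0" "0 \<le> x" "x < 2 * pi" "0 \<le> y" "y < 2 * pi"
  shows "x = y \<and> r = s"
proof -
  define l where "l x = sqrt ((a x)\<^sup>2 + (deriv a x)\<^sup>2)" for x
  have l: "l x > 0" for x unfolding l_def using a_pos[of x] by (simp add: add_pos_nonneg)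
  have eq: "(r * l x) *\<^sub>R e_r (polar_angle x) = (s * l y) *\<^sub>R e_r (polar_angle y)"
    using assms(1) by (simp add: p_polar l_def)
  then have "norm ((r * l x) *\<^sub>R e_r (polar_angle x)) = norm ((s * l y) *\<^sub>R e_r (polar_angle y))" by simp
  then have rl: "r * l x = s * l y" using l[of x] l[of y] assms by (simp add: abs_of_pos)
  then have "e_r (polar_angle x) = e_r (polar_angle y)" using eq l[of y] assms by simp
  then have "cos (polar_angle x) = cos (polar_angle y) \<and> sin (polar_angle x) = sin (polar_angle y)"
    by (simp add: e_r_def vec_eq_iff forall_2)
  then obtain n :: int where n: "polar_angle x = polar_angle y + 2 * pi * n"
    using sin_cos_eq_iff by blast
  have "polar_angle x < polar_angle y + 2 * pi * 1"
    using strict_monoD[OF polar_angle_strict_mono, of x "y + 2 * pi"] assms by (simp add: polar_angle_shift)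
  moreover have "polar_angle y + 2 * pi * (-1) < polar_angle x"
    using strict_monoD[OF polar_angle_strict_mono, of y "x + 2 * pi"] assms by (simp add: polar_angle_shift)
  ultimately have "real_of_int n < 1 \<and> -1 < real_of_int n"
    unfolding n by (metis add_less_cancel_left mult_less_cancel_left_pos pi_gt_zero zero_less_mult_iff zero_less_numeral)
  then have "n = 0" by linarith
  then have "x = y" using n strict_mono_eq[OF polar_angle_strict_mono] by simp
  moreover have "r = s" using rl l[of y] \<open>x = y\<close> by simp
  ultimately show ?thesis by simp
qed

definition polar_map :: "real ^ 2 \<Rightarrow> real ^ 2" where
  "polar_map x = (x $ 1) *\<^sub>R p_curve a (x $ 2)"

text \<open>
  Radius 0 is excluded, since the whole segment of radius 0 would be mapped to the origin.
\<close>
definition polar_domain :: "(real ^ 2) set" where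
  "polar_domain = {x. 0 < x $ 1 \<and> x $ 1 \<le> 1 \<and> 0 \<le> x $ 2 \<and> x $ 2 < 2 * pi}"

lemma p_nonzero: "p_curve a x \<noteq> 0"
proof
  assume "p_curve a x = 0"
  then have "bracket (p_curve a x) (p_curve' a x) = 0" by (simp add: bracket_linear)
  then show False using a_pos[of x] a_convexity[of x] by (simp add: bracket_p_p')
qed

text \<open>
  A ray from the interior point 0 leaves the convex set \<open>P\<close> at a frontier point, that is, at some
  \<open>p_curve a z\<close>, and everything before that point belongs to \<open>P\<close>.
\<close>
lemma polar_map_image: "polar_map ` polar_domain = P - {0}"
proof (intro set_eqI iffI)
  fix y assume "y \<in> polar_map ` polar_domain"
  then obtain x :: "real ^ 2" where x: "0 < x $ 1" "x $ 1 \<le> 1" "y = (x $ 1) *\<^sub>R p_curve a (x $ 2)"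
    by (auto simp: polar_map_def polar_domain_def)
  have "0 \<in> P" using zero_interior interior_subset by blast
  then have "(1 - x $ 1) *\<^sub>R 0 + (x $ 1) *\<^sub>R p_curve a (x $ 2) \<in> P"
    using x p_in_P by (intro convexD[OF P_convex]) auto
  moreover have "p_curve a (x $ 2) \<noteq> 0"
    using p_nonzero .
  ultimately show "y \<in> P - {0}" using x by auto
next
  fix y assume y: "y \<in> P - {0}"
  obtain d where d: "d > 0" "0 + d *\<^sub>R y \<in> frontier P"
    using ray_to_frontier[OF compact_imp_bounded[OF P_compact] zero_interior, of y] y by auto
  have "d \<ge> 1"
  proof (rule ccontr)
    assume "\<not> 1 \<le> d"
    then have "d *\<^sub>R y \<in> open_segment 0 y" using d y by (auto simp: in_segment)
    then have "d *\<^sub>R y \<in> interior P"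
      using in_interior_closure_convex_segment[OF P_convex zero_interior] y closure_subset by blast
    then show False using d by (simp add: frontier_def)
  qed
  obtain z where z: "d *\<^sub>R y = p_curve a z" using d p_frontier by auto
  define w where "w = z + 2 * pi * of_int (- \<lfloor>z / (2 * pi)\<rfloor>)"
  have w: "0 \<le> w" "w < 2 * pi"
    using floor_divide_lower[of "2 * pi" z] floor_divide_upper[of "2 * pi" z]
    by (auto simp: w_def algebra_simps)
  have "p_curve a w = d *\<^sub>R y" unfolding w_def p_periodic_int z ..
  then have "y = polar_map (vector [1 / d, w])" using d by (simp add: polar_map_def)
  moreover have "vector [1 / d, w] \<in> polar_domain" using w d \<open>d \<ge> 1\<close> by (simp add: polar_domain_def)
  ultimately show "y \<in> polar_map ` polar_domain" by blast
qed

lemma polar_map_inj: "inj_on polar_map polar_domain"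
proof (rule inj_onI)
  fix x y assume "x \<in> polar_domain" "y \<in> polar_domain" "polar_map x = polar_map y"
  then have "x $ 2 = y $ 2 \<and> x $ 1 = y $ 1"
    by (intro same_ray_imp_eq) (simp_all add: polar_map_def polar_domain_def)
  then show "x = y" by (simp add: vec_eq_iff forall_2)
qed

text \<open>
  The map \<open>(r, x) \<mapsto> r p(x)\<close> is a bijection onto the punctured ball with Jacobian \<open>r [p, p']\<close>, and the
  factor \<open>1 / 2\<close> is the integral of \<open>r\<close>.
\<close>
theorem measure_unit_ball:
  "measure lebesgue P = 1 / 2 * integral {0..2 * pi} (\<lambda>x. bracket (p_curve a x) (p_curve' a x))"
proof -
  define w where "w x = bracket (p_curve a x) (p_curve' a x)" for x
  define D where "D x h = (h $ 1) *\<^sub>R p_curve a (x $ 2) + (x $ 1 * h $ 2) *\<^sub>R p_curve' a (x $ 2)" for x h :: "real ^ 2"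
  have w_cont: "continuous_on S w" for S
    unfolding w_def[abs_def] bracket_p_p'
    by (intro continuous_intros continuous_on_subset[OF a_cont] continuous_on_subset[OF a_cont2] subset_UNIV)
  have w_pos: "w x > 0" for x unfolding w_def bracket_p_p' using a_pos a_convexity by simp
  have det: "\<bar>det (matrix (D x))\<bar> = x $ 1 * w (x $ 2)" if "x \<in> polar_domain" for x
  proof -
    have "det (matrix (D x)) = x $ 1 * w (x $ 2)"
      by (simp add: det_2 matrix_def D_def w_def bracket_components axis_def algebra_simps)
    then show ?thesis using that w_pos[of "x $ 2"] by (simp add: polar_domain_def)
  qed
  have deriv: "(polar_map has_derivative D x) (at x within S)" for x S
  proof -
    have "(p_curve a has_derivative (\<lambda>h. h *\<^sub>R p_curve' a (x $ 2))) (at (x $ 2))"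
      using p_has_vector_derivative by (simp add: p_curve'_eq has_vector_derivative_def)
    moreover have "((\<lambda>x :: real ^ 2. x $ 2) has_derivative (\<lambda>h. h $ 2)) (at x within S)"
      by (rule bounded_linear_imp_has_derivative[OF bounded_linear_vec_nth])
    ultimately have "((\<lambda>x. p_curve a (x $ 2)) has_derivative (\<lambda>h. (h $ 2) *\<^sub>R p_curve' a (x $ 2))) (at x within S)"
      using has_derivative_compose[of "\<lambda>x :: real ^ 2. x $ 2" "\<lambda>h :: real ^ 2. h $ 2" x S "p_curve a"] by blast
    then show ?thesis unfolding polar_map_def[abs_def] D_def
      by (auto intro!: derivative_eq_intros bounded_linear_imp_has_derivative[OF bounded_linear_vec_nth])
  qed
  let ?C = "cbox (vector [0, 0]) (vector [1, 2 * pi]) :: (real ^ 2) set"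
  let ?H = "{x :: real ^ 2. x $ 1 = 0} \<union> {x. x $ 2 = 2 * pi}"
  have "negligible {x :: real ^ 2. x $ i = c}" for i c
    using negligible_standard_hyperplane[of "axis i 1 :: real ^ 2" c] by (simp add: inner_axis axis_in_Basis_iff)
  then have H: "negligible ?H" by (intro negligible_Un)
  have dom: "polar_domain = ?C - ?H"
    by (rule set_eqI) (simp add: polar_domain_def mem_box_cart forall_2, linarith)
  have meas: "polar_domain \<in> sets lebesgue"
    unfolding dom using negligible_imp_sets[OF H] fmeasurableD[OF lmeasurable_cbox] by blast
  have "((\<lambda>x :: real ^ 2. x $ 1 * w (x $ 2)) has_integral integral {0..1} (\<lambda>x. integral {0..2 * pi} (\<lambda>y. x * w y))) ?C"
  proof -
    have "continuous_on S (\<lambda>z :: real \<times> real. fst z * w (snd z))" for S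
      by (intro continuous_intros continuous_on_compose2[OF w_cont[of UNIV]]) auto
    from has_integral_vec2[OF this, where a=0 and b=1 and c=0 and d="2 * pi"] show ?thesis by (simp only: fst_conv snd_conv)
  qed
  moreover have "integral {0..1} (\<lambda>x. integral {0..2 * pi} (\<lambda>y. x * w y)) = 1 / 2 * integral {0..2 * pi} w"
    using integral_unique[OF ident_has_integral[of 0 "1::real"]] by simp
  ultimately have "((\<lambda>x :: real ^ 2. x $ 1 * w (x $ 2)) has_integral 1 / 2 * integral {0..2 * pi} w) ?C" by simp
  moreover have "((\<lambda>x :: real ^ 2. x $ 1 * w (x $ 2)) has_integral 1 / 2 * integral {0..2 * pi} w) ?C \<longleftrightarrow>
      ((\<lambda>x :: real ^ 2. x $ 1 * w (x $ 2)) has_integral 1 / 2 * integral {0..2 * pi} w) polar_domain"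
    by (intro has_integral_spike_set_eq negligible_subset[OF H]) (auto simp: dom)
  ultimately have "((\<lambda>x :: real ^ 2. x $ 1 * w (x $ 2)) has_integral 1 / 2 * integral {0..2 * pi} w) polar_domain"
    by (simp only:)
  then have int: "((\<lambda>x. \<bar>det (matrix (D x))\<bar>) has_integral 1 / 2 * integral {0..2 * pi} w) polar_domain"
    by (rule has_integral_eq[rotated]) (simp add: det)
  have "measure lebesgue (polar_map ` polar_domain) = integral polar_domain (\<lambda>x. \<bar>det (matrix (D x))\<bar>)"
    using has_integral_integrable[OF int]
    by (rule measure_differentiable_image_eq[OF meas deriv polar_map_inj])
  then have "measure lebesgue (P - {0}) = 1 / 2 * integral {0..2 * pi} w"
    by (simp only: polar_map_image integral_unique[OF int])
  moreover have "measure lebesgue (P - {0}) = measure lebesgue P"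
    using lmeasurable_compact[OF P_compact]
    by (intro measure_Diff_null_set) (simp_all add: fmeasurableD flip: negligible_iff_null_sets)
  ultimately show ?thesis by (simp add: w_def[abs_def])
qed

end

section \<open>Rotation of the tangent of a simple closed curve\<close>

text \<open>
  Any two values of \<open>f\<close> differ by a multiple of \<open>2 \<pi> \<i>\<close>, so distinct values have distance at least 1 and
  a continuous \<open>f\<close> cannot jump between them.
\<close>
lemma continuous_exp_lift_constant:
  fixes f :: "'a::topological_space \<Rightarrow> complex"
  assumes "connected S" "continuous_on S f" and k: "\<And>x. x \<in> S \<Longrightarrow> exp (f x) = k"
    and "x \<in> S" "y \<in> S"
  shows "f x = f y"
proof -
  have "f constant_on S"
  proof (rule continuous_discrete_range_constant[OF assms(1,2)])
    fix x assume x: "x \<in> S"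
    have "1 \<le> norm (f y - f x)" if y: "y \<in> S" "f y \<noteq> f x" for y
    proof -
      obtain n :: int where n: "f y = f x + (of_int (2 * n) * pi) * \<i>"
        using k[OF x] k[OF y(1)] exp_eq[of "f y" "f x"] by auto
      then have "n \<noteq> 0" using y by auto
      then have "1 \<le> \<bar>real_of_int n\<bar>" by linarith
      moreover have "norm (f y - f x) = \<bar>real_of_int n\<bar> * (2 * pi)"
        unfolding n by (simp add: norm_mult)
      moreover have "\<bar>real_of_int n\<bar> * 1 \<le> \<bar>real_of_int n\<bar> * (2 * pi)"
        using pi_gt3 by (intro mult_left_mono) auto
      ultimately show ?thesis by linarith
    qed
    then show "\<exists>e>0. \<forall>y. y \<in> S \<and> f y \<noteq> f x \<longrightarrow> e \<le> norm (f y - f x)"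
      by (intro exI[of _ 1]) auto
  qed
  then show ?thesis using assms(4,5) by (auto simp: constant_on_def)
qed

lemma continuous_cis_lift_constant:
  fixes f :: "'a::topological_space \<Rightarrow> real"
  assumes "connected S" "continuous_on S f" and k: "\<And>x. x \<in> S \<Longrightarrow> cis (f x) = k"
    and "x \<in> S" "y \<in> S"
  shows "f x = f y"
proof -
  have "\<i> * complex_of_real (f x) = \<i> * complex_of_real (f y)"
    by (rule continuous_exp_lift_constant[of S "\<lambda>x. \<i> * of_real (f x)" k x y])
       (use assms in \<open>auto intro!: continuous_intros simp: cis_conv_exp\<close>)
  then show ?thesis by simp
qed

lemma cis_eq_imp_diff: "cis a = cis b \<Longrightarrow> \<exists>n::int. a - b = 2 * pi * of_int n"
  using sin_cos_eq_iff[of a b] by (auto simp: complex_eq_iff)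

text \<open>
  Just outside the interval from 0 to \<open>\<pi>\<close> the sine is negative, and by the intermediate value theorem
  a continuous function cannot skip these values.
\<close>
lemma sin_nonneg_imp_between_0_pi:
  fixes f :: "real \<Rightarrow> real"
  assumes cont: "continuous_on {0..<b} f" and f0: "f 0 = 0"
    and sin: "\<And>x. 0 \<le> x \<Longrightarrow> x < b \<Longrightarrow> sin (f x) \<ge> 0" and x: "0 \<le> x" "x < b"
  shows "0 \<le> f x \<and> f x \<le> pi"
proof (rule ccontr)
  assume *: "\<not> (0 \<le> f x \<and> f x \<le> pi)"
  have cx: "continuous_on {0..x} f" by (rule continuous_on_subset[OF cont]) (use x in auto)
  show False
  proof (cases "f x < 0")
    case True
    \<comment> \<open>a value between \<open>f x\<close> and 0 at which the sine is negative, however small \<open>f x\<close> is\<close>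
    define y where "y = max (f x) (- pi / 2)"
    have y: "- pi < y" "y < 0" "f x \<le> y" using True pi_gt_zero by (auto simp: y_def less_max_iff_disj)
    then obtain t where t: "0 \<le> t" "t \<le> x" "f t = y"
      using IVT2'[of f x y 0] f0 x cx by force
    have "sin y < 0" using y sin_gt_zero[of "-y"] by simp
    then show False using sin[of t] t x by simp
  next
    case False
    then have "f x > pi" using * by simp
    define y where "y = min (f x) (3 * pi / 2)"
    have y: "pi < y" "y < 2 * pi" "y \<le> f x" using \<open>f x > pi\<close> pi_gt_zero by (auto simp: y_def min_less_iff_disj)
    then obtain t where t: "0 \<le> t" "t \<le> x" "f t = y"
      using IVT'[of f 0 y x] f0 x cx pi_gt_zero by force
    have "sin y < 0" using y sin_gt_zero[of "y - pi"] by (simp add: sin_diff)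
    then show False using sin[of t] t x by simp
  qed
qed

text \<open>
  Closed curves are parametrised over the whole line with period \<open>2 \<pi>\<close>, so that secants across the
  base point need no special treatment.
\<close>
locale simple_regular_closed_curve =
  fixes c c' :: "real \<Rightarrow> complex"
  assumes c_deriv: "(c has_vector_derivative c' u) (at u)"
    and c'_cont: "continuous_on UNIV c'"
    and c'_nonzero: "c' u \<noteq> 0"
    and c_periodic: "c (u + 2 * pi) = c u"
    and c_simple: "c u = c w \<Longrightarrow> \<exists>n::int. u = w + 2 * pi * of_int n"
begin

lemma c_cont: "continuous_on S c"
  using c_deriv by (meson continuous_at_imp_continuous_on has_vector_derivative_continuous)

lemma c_periodic_int: "c (u + 2 * pi * of_int n) = c u"
proof -
  interpret periodic_fun_simple c "2 * pi" by unfold_locales (rule c_periodic)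
  show ?thesis using plus_of_int[of u n] by (simp add: mult.commute)
qed

lemma c'_periodic: "c' (u + 2 * pi) = c' u"
proof -
  have "((c \<circ> (\<lambda>u. u + 2 * pi)) has_vector_derivative 1 *\<^sub>R c' (u + 2 * pi)) (at u)"
    by (rule vector_diff_chain_at) (auto intro!: derivative_eq_intros c_deriv)
  then have "(c has_vector_derivative c' (u + 2 * pi)) (at u)" by (simp add: o_def c_periodic)
  then show ?thesis using c_deriv vector_derivative_unique_at by blast
qed

lemma c_neq: "0 < d \<Longrightarrow> d < 2 * pi \<Longrightarrow> c (s + d) \<noteq> c s"
proof
  assume d: "0 < d" "d < 2 * pi" "c (s + d) = c s"
  then obtain n :: int where n: "d = 2 * pi * of_int n" using c_simple[of "s + d" s] by auto
  then have "0 < real_of_int n" "real_of_int n < 1" using d by (simp_all add: zero_less_mult_iff)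
  then show False by simp
qed

text \<open>
  The chord from \<open>c s\<close> to \<open>c (s + d)\<close> divided by \<open>d\<close>. As a mean value of the velocity it is also defined
  for \<open>d = 0\<close>, where it is the tangent vector, and it is continuous in both variables.
\<close>
definition secant :: "real \<Rightarrow> real \<Rightarrow> complex" where
  "secant s d = integral {0..1} (\<lambda>l. c' (s + l * d))"

lemma secant_eq: "d *\<^sub>R secant s d = c (s + d) - c s"
proof -
  have "((\<lambda>l. d *\<^sub>R c' (s + l * d)) has_integral c (s + 1 * d) - c (s + 0 * d)) {0..1}"
  proof (rule fundamental_theorem_of_calculus)
    fix l :: real
    have "((c \<circ> (\<lambda>l. s + l * d)) has_vector_derivative d *\<^sub>R c' (s + l * d)) (at l within {0..1})"
      by (rule vector_diff_chain_within) (auto intro!: derivative_eq_intros has_vector_derivative_at_within[OF c_deriv])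
    then show "((\<lambda>l. c (s + l * d)) has_vector_derivative d *\<^sub>R c' (s + l * d)) (at l within {0..1})"
      by (simp add: o_def)
  qed auto
  from integral_unique[OF this] show ?thesis unfolding secant_def by simp
qed

lemma secant_0: "secant s 0 = c' s"
  by (simp add: secant_def)

lemma secant_cont: "continuous_on S (\<lambda>(s, d). secant s d)"
proof -
  have "continuous_on (UNIV \<times> cbox 0 1) (\<lambda>(x, l). c' (fst x + l * snd x))"
    unfolding case_prod_unfold
    by (rule continuous_on_compose2[OF c'_cont]) (auto intro!: continuous_intros)
  from integral_continuous_on_param[OF this]
  have "continuous_on UNIV (\<lambda>(s, d). secant s d)"
    by (simp add: secant_def case_prod_unfold)
  then show ?thesis by (rule continuous_on_subset) simp
qed

lemma sgn_secant: "d > 0 \<Longrightarrow> sgn (secant s d) = sgn (c (s + d) - c s)"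
  by (simp flip: secant_eq add: sgn_scaleR)

lemma secant_nonzero: "0 \<le> d \<Longrightarrow> d < 2 * pi \<Longrightarrow> secant s d \<noteq> 0"
  using c'_nonzero secant_0 c_neq[of d s] secant_eq[of d s] by (cases "d = 0") auto

text \<open>
  By simplicity of the curve the secants do not vanish, and they are parametrised by a convex set, on which
  a continuous logarithm exists.
\<close>
lemma secant_angle:
  obtains ang where "continuous_on (UNIV \<times> {0..<2 * pi}) ang"
    "\<And>s d. 0 \<le> d \<Longrightarrow> d < 2 * pi \<Longrightarrow> sgn (secant s d) = cis (ang (s, d))"
proof -
  let ?D = "UNIV \<times> {0..<2 * pi} :: (real \<times> real) set"
  have "contractible ?D" by (intro convex_imp_contractible convex_Times) auto
  moreover have "(\<lambda>(s, d). secant s d) x \<noteq> 0" if "x \<in> ?D" for x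
    using that secant_nonzero by auto
  ultimately obtain g where g: "continuous_on ?D g" "\<And>x. x \<in> ?D \<Longrightarrow> (\<lambda>(s, d). secant s d) x = exp (g x)"
    using continuous_logarithm_on_contractible[OF secant_cont[of ?D]] by blast
  show thesis
  proof
    show "continuous_on ?D (\<lambda>x. Im (g x))" by (intro continuous_intros g)
    fix s d :: real assume "0 \<le> d" "d < 2 * pi"
    then have "secant s d = exp (g (s, d))" using g(2)[of "(s, d)"] by simp
    then show "sgn (secant s d) = cis (Im (g (s, d)))"
      by (simp add: sgn_eq exp_eq_polar norm_mult)
  qed
qed

lemma lowest_point:
  obtains u0 where "\<And>u. Im (c u0) \<le> Im (c u)"
proof -
  have "continuous_on {0..2 * pi} (\<lambda>u. Im (c u))" by (intro continuous_intros c_cont)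
  then have "\<exists>u0\<in>{0..2 * pi}. \<forall>u\<in>{0..2 * pi}. Im (c u0) \<le> Im (c u)"
    by (intro continuous_attains_inf) auto
  then obtain u0 where u0: "\<And>u. u \<in> {0..2 * pi} \<Longrightarrow> Im (c u0) \<le> Im (c u)" by blast
  show thesis
  proof
    fix u
    let ?w = "u + 2 * pi * of_int (- \<lfloor>u / (2 * pi)\<rfloor>)"
    have "?w \<in> {0..2 * pi}"
      using floor_divide_lower[of "2 * pi" u] floor_divide_upper[of "2 * pi" u] by (auto simp: algebra_simps)
    then show "Im (c u0) \<le> Im (c u)" using u0[of ?w] c_periodic_int[of u] by metis
  qed
qed

lemma lowest_point_horizontal:
  assumes "\<And>u. Im (c u0) \<le> Im (c u)"
  shows "Im (c' u0) = 0"
proof -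
  have "((\<lambda>u. Im (c u)) has_real_derivative Im (c' u0)) (at u0)"
    using bounded_linear.has_vector_derivative[OF bounded_linear_Im c_deriv] by (simp add: has_real_derivative_iff_has_vector_derivative)
  then show ?thesis by (rule DERIV_local_min[of _ _ _ 1]) (use assms in auto)
qed

text \<open>
  Let \<open>ang (s, d)\<close> be the angle of the secant from \<open>c s\<close> to \<open>c (s + d)\<close>. The reversed secant
  starts at \<open>s + d\<close> and has length parameter \<open>2 \<pi> - d\<close>; so \<open>ang (s, d) - ang (s + d, 2 \<pi> - d)\<close> is a
  constant \<open>M\<close>, an odd multiple of \<open>\<pi>\<close>. Reversing twice leads from \<open>(s, d)\<close> to \<open>(s + 2 \<pi>, d)\<close>, hence
  the angles grow by \<open>- 2 M\<close> per period. To find \<open>M\<close>, look at the lowest point \<open>u0\<close>. Its tangent has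
  angle 0 after normalisation, and the secants starting there point upwards, so their angles remain between
  0 and \<open>\<pi>\<close>. The short secants that end at \<open>u0\<close> are reversals of these, with angles between \<open>M\<close> and
  \<open>M + \<pi>\<close>, but they approach the tangent, so their angles tend to 0. Thus \<open>- \<pi> \<le> M \<le> 0\<close>, which
  leaves \<open>M = - \<pi>\<close>.
\<close>
lemma tangent_rotation_if_rightward:
  assumes low: "\<And>u. Im (c u0) \<le> Im (c u)" and right: "Re (c' u0) > 0"
    and \<phi>: "continuous_on UNIV \<phi>" "\<And>u. sgn (c' u) = cis (\<phi> u)"
  shows "\<phi> (u + 2 * pi) = \<phi> u + 2 * pi"
proof -
  obtain ang where ang_cont: "continuous_on (UNIV \<times> {0..<2 * pi}) ang"
    and ang: "\<And>s d. 0 \<le> d \<Longrightarrow> d < 2 * pi \<Longrightarrow> sgn (secant s d) = cis (ang (s, d))"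
    using secant_angle by blast
  have ang_compose: "continuous_on A (\<lambda>x. ang (f x, g x))"
    if "continuous_on A f" "continuous_on A g" "\<And>x. x \<in> A \<Longrightarrow> 0 \<le> g x \<and> g x < 2 * pi" for A f g
    by (rule continuous_on_compose2[OF ang_cont]) (use that in \<open>auto intro!: continuous_intros\<close>)
  have shift: "ang (s + 2 * pi, d) - ang (s, d) = ang (2 * pi, 0) - ang (0, 0)" if d: "0 \<le> d" "d < 2 * pi" for s d
  proof -
    let ?D = "UNIV \<times> {0..<2 * pi} :: (real \<times> real) set"
    let ?f = "\<lambda>x. ang (fst x + 2 * pi, snd x) - ang (fst x, snd x)"
    have "?f (s, d) = ?f (0, 0)"
    proof (rule continuous_cis_lift_constant[of ?D ?f 1])
      show "connected ?D" by (intro convex_connected convex_Times) auto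
      show "continuous_on ?D (\<lambda>x. ang (fst x + 2 * pi, snd x) - ang (fst x, snd x))"
        by (intro continuous_intros ang_compose) auto
      fix x assume x: "x \<in> ?D"
      have "secant (fst x + 2 * pi) (snd x) = secant (fst x) (snd x)"
        unfolding secant_def using c'_periodic by (metis add.assoc add.commute)
      then have "cis (ang (fst x + 2 * pi, snd x)) = cis (ang (fst x, snd x))"
        using ang x by (metis SigmaE atLeastLessThan_iff fst_conv snd_conv)
      then show "cis (ang (fst x + 2 * pi, snd x) - ang (fst x, snd x)) = 1"
        by (simp flip: cis_divide)
    qed (use d in auto)
    then show ?thesis by simp
  qed
  obtain M where M: "\<And>s d. 0 < d \<Longrightarrow> d < 2 * pi \<Longrightarrow> ang (s, d) - ang (s + d, 2 * pi - d) = M" and odd: "cis M = - 1"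
  proof -
    let ?D = "UNIV \<times> {0<..<2 * pi} :: (real \<times> real) set"
    let ?f = "\<lambda>x. ang (fst x, snd x) - ang (fst x + snd x, 2 * pi - snd x)"
    have cis: "cis (?f x) = - 1" if x: "x \<in> ?D" for x
    proof -
      obtain s d where sd: "x = (s, d)" "0 < d" "d < 2 * pi" using x by auto
      have "sgn (secant s d) = sgn (c (s + d) - c s)" using sd by (simp add: sgn_secant)
      also have "\<dots> = - sgn (c (s + 2 * pi) - c (s + d))"
        by (simp add: c_periodic flip: sgn_minus)
      also have "sgn (c (s + 2 * pi) - c (s + d)) = sgn (secant (s + d) (2 * pi - d))"
        using sgn_secant[of "2 * pi - d" "s + d"] sd by simp
      finally have "cis (ang (s, d)) = - cis (ang (s + d, 2 * pi - d))" using ang sd by simp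
      then show ?thesis using sd by (simp flip: cis_divide)
    qed
    have "?f x = ?f (0, pi)" if "x \<in> ?D" for x
    proof (rule continuous_cis_lift_constant[of ?D ?f "-1"])
      show "connected ?D" by (intro convex_connected convex_Times) auto
      show "continuous_on ?D ?f" by (intro continuous_intros ang_compose) auto
    qed (use cis that in auto)
    then show thesis using that[of "?f (0, pi)"] cis[of "(0, pi)"] by force
  qed
  \<comment> \<open>the secant with \<open>s = 0\<close> and \<open>d = \<pi>\<close> is reversed twice\<close>
  have N: "ang (2 * pi, 0) - ang (0, 0) = - 2 * M"
    using M[of pi 0] M[of pi pi] shift[of pi 0] pi_gt_zero by simp
  define f where "f d = ang (u0, d) - ang (u0, 0)" for d
  have tangent0: "cis (ang (u0, 0)) = 1"
  proof -
    have "c' u0 = of_real (Re (c' u0))" using lowest_point_horizontal[OF low] by (simp add: complex_eq_iff)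
    then have "sgn (c' u0) = 1" using right by (metis of_real_1 sgn_of_real sgn_pos)
    then show ?thesis using ang[of 0 u0] by (simp add: secant_0)
  qed
  have f: "0 \<le> f d \<and> f d \<le> pi" if d: "0 \<le> d" "d < 2 * pi" for d
  proof (rule sin_nonneg_imp_between_0_pi[of "2 * pi" f])
    show "continuous_on {0..<2 * pi} f"
      unfolding f_def by (intro continuous_intros ang_compose) auto
    fix x assume x: "0 \<le> x" "x < 2 * pi"
    have "cis (f x) = sgn (secant u0 x)" using ang[OF x] tangent0 by (simp add: f_def flip: cis_divide)
    moreover have "Im (sgn (secant u0 x)) \<ge> 0"
    proof (cases "x = 0")
      case True then show ?thesis using tangent0 ang[of 0 u0] by simp
    next
      case False then show ?thesis using sgn_secant[of x u0] x low[of "u0 + x"] by (simp add: Im_sgn)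
    qed
    ultimately show "0 \<le> sin (f x)" by (metis cis.sel(2))
  qed (use d in \<open>auto simp: f_def\<close>)
  have "((\<lambda>d. ang (u0 - d, d) - ang (u0, 0)) \<longlongrightarrow> ang (u0 - 0, 0) - ang (u0, 0)) (at 0 within {0..pi})"
  proof -
    have "continuous_on {0..pi} (\<lambda>d. ang (u0 - d, d) - ang (u0, 0))"
      using pi_gt_zero by (intro continuous_intros ang_compose) (auto simp del: pi_gt_zero)
    then show ?thesis unfolding continuous_on_def by (rule bspec) simp
  qed
  then have lim: "((\<lambda>d. ang (u0 - d, d) - ang (u0, 0)) \<longlongrightarrow> 0) (at_right 0)"
    using at_within_Icc_at_right[of 0 pi] by simp
  have ev: "\<forall>\<^sub>F d in at_right 0. ang (u0 - d, d) - ang (u0, 0) \<in> {M..M + pi}"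
  proof (rule eventually_mono)
    show "\<forall>\<^sub>F d in at_right 0. d \<in> {0<..<2 * pi}" by (rule eventually_at_right_real) simp
    fix d :: real assume "d \<in> {0<..<2 * pi}"
    then show "ang (u0 - d, d) - ang (u0, 0) \<in> {M..M + pi}"
      using M[of d "u0 - d"] f[of "2 * pi - d"] by (auto simp: f_def)
  qed
  have "M \<le> 0"
    by (rule tendsto_lowerbound[OF lim]) (use ev in \<open>auto elim: eventually_mono\<close>)
  moreover have "0 \<le> M + pi"
    by (rule tendsto_upperbound[OF lim]) (use ev in \<open>auto elim: eventually_mono\<close>)
  moreover obtain n :: int where n: "M - pi = 2 * pi * of_int n"
    using odd cis_eq_imp_diff[of M pi] by auto
  moreover define X where "X = of_int n * pi"
  moreover have "M = pi + 2 * X" using n by (simp add: X_def algebra_simps)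
  ultimately have "X < 0" "- 2 * pi < X" using pi_gt_zero by linarith+
  then have "of_int n * pi < 0 * pi" "(-2) * pi < of_int n * pi" by (simp_all only: X_def mult_zero_left)
  then have "real_of_int n < 0" "-2 < real_of_int n" by (simp_all only: mult_less_cancel_right_pos pi_gt_zero)
  then have "n = -1" by linarith
  then have "M = - pi" using n by simp
  have "\<phi> (u + 2 * pi) - ang (u + 2 * pi, 0) = \<phi> u - ang (u, 0)"
  proof (rule continuous_cis_lift_constant[of UNIV "\<lambda>u. \<phi> u - ang (u, 0)" 1])
    show "continuous_on UNIV (\<lambda>u. \<phi> u - ang (u, 0))" by (intro continuous_intros \<phi> ang_compose) auto
    fix x show "cis (\<phi> x - ang (x, 0)) = 1"
      using ang[of 0 x] \<phi>(2)[of x] by (simp add: secant_0 flip: cis_divide)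
  qed auto
  then show ?thesis using shift[of 0 u] N \<open>M = - pi\<close> by simp
qed

definition circuit :: "real \<Rightarrow> complex" where
  "circuit x = c (2 * pi * x)"

lemma path_circuit: "path circuit"
  unfolding path_def circuit_def by (rule continuous_on_compose2[OF c_cont[of UNIV]]) (auto intro!: continuous_intros)

lemma path_image_circuit: "path_image circuit = range c"
proof -
  have "c u \<in> path_image circuit" for u
  proof -
    let ?w = "u + 2 * pi * of_int (- \<lfloor>u / (2 * pi)\<rfloor>)"
    have "0 \<le> ?w" "?w \<le> 2 * pi"
      using floor_divide_lower[of "2 * pi" u] floor_divide_upper[of "2 * pi" u] by (auto simp: algebra_simps)
    moreover have "c u = circuit (?w / (2 * pi))" unfolding circuit_def using c_periodic_int[of u "- \<lfloor>u / (2 * pi)\<rfloor>"] by simp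
    ultimately show ?thesis unfolding path_image_def by (metis atLeastAtMost_iff divide_le_eq_1 image_eqI divide_nonneg_pos pi_gt_zero zero_less_mult_iff zero_less_numeral)
  qed
  then show ?thesis by (auto simp: path_image_def circuit_def)
qed

text \<open>
  Take \<open>z\<close> slightly above the lowest point, and let \<open>w = c - z\<close>. On a short arc through the lowest point
  \<open>w\<close> crosses the imaginary axis only below the origin, so it avoids the upper imaginary half-axis; on the
  rest of the curve it avoids the lower one. On each of the two arcs a rotated principal logarithm therefore
  measures the change of the argument of \<open>w\<close>. At the two points where the arcs meet, the signs of the real
  parts of \<open>w\<close> bound these changes, and their sum, a multiple of \<open>2 \<pi>\<close> strictly between \<open>- 4 \<pi>\<close>
  and 0, can only be \<open>- 2 \<pi>\<close>.
\<close>
lemma winding_number_near_lowest_point_if_leftward: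
  assumes low: "\<And>u. Im (c u0) \<le> Im (c u)" and left: "Re (c' u0) < 0"
  obtains z where "z \<notin> range c" "winding_number circuit z = - 1"
proof -
  have "continuous_on UNIV (\<lambda>u. Re (c' u))" by (intro continuous_intros c'_cont)
  then obtain \<delta>0 where \<delta>0: "\<delta>0 > 0" "\<And>u. dist u u0 < \<delta>0 \<Longrightarrow> dist (Re (c' u)) (Re (c' u0)) < - Re (c' u0)"
    using left unfolding continuous_on_iff by (metis UNIV_I neg_0_less_iff_less)
  define \<delta> where "\<delta> = min (\<delta>0 / 2) (pi / 2)"
  have \<delta>: "\<delta> > 0" "\<delta> < \<delta>0" "\<delta> < pi" using \<delta>0 pi_gt_zero by (auto simp: \<delta>_def min_less_iff_disj)
  have Re_decreasing: "Re (c (u0 + y)) < Re (c (u0 + x))" if "- \<delta> \<le> x" "x < y" "y \<le> \<delta>" for x y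
  proof (rule DERIV_neg_imp_decreasing[OF that(2)])
    fix t assume t: "x \<le> t" "t \<le> y"
    have "((\<lambda>u. Re (c u)) has_real_derivative Re (c' (t + u0))) (at (t + u0))"
      using bounded_linear.has_vector_derivative[OF bounded_linear_Re c_deriv]
      by (simp add: has_real_derivative_iff_has_vector_derivative)
    then have "((\<lambda>u. Re (c (u0 + u))) has_real_derivative Re (c' (t + u0))) (at t)"
      by (simp add: DERIV_shift add.commute)
    moreover have "dist (t + u0) u0 < \<delta>0" using t that \<delta> by (simp add: dist_real_def abs_less_iff)
    then have "Re (c' (t + u0)) < 0" using \<delta>0(2)[of "t + u0"] by (auto simp: dist_real_def abs_less_iff)
    ultimately show "\<exists>D. ((\<lambda>u. Re (c (u0 + u))) has_real_derivative D) (at t) \<and> D < 0" by blast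
  qed
  let ?K = "{\<delta>..2 * pi - \<delta>}"
  have "continuous_on ?K (\<lambda>t. norm (c (u0 + t) - c u0))"
    by (intro continuous_intros continuous_on_compose2[OF c_cont[of UNIV]]) auto
  then have "\<exists>t\<in>?K. \<forall>s\<in>?K. norm (c (u0 + t) - c u0) \<le> norm (c (u0 + s) - c u0)"
    by (intro continuous_attains_inf) (use \<delta> in auto)
  then obtain t0 where t0: "t0 \<in> ?K" "\<And>s. s \<in> ?K \<Longrightarrow> norm (c (u0 + t0) - c u0) \<le> norm (c (u0 + s) - c u0)"
    by blast
  \<comment> \<open>less than the distance from the lowest point to the far arc, so that the far arc passes the axis above \<open>z\<close>\<close>
  define \<epsilon> where "\<epsilon> = norm (c (u0 + t0) - c u0) / 2"
  have \<epsilon>: "\<epsilon> > 0" using c_neq[of t0 u0] t0 \<delta> by (auto simp: \<epsilon>_def)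
  define z where "z = c u0 + \<epsilon> *\<^sub>R \<i>"
  define w where "w t = c (u0 + t) - z" for t
  have w_cont: "continuous_on S w" for S
    unfolding w_def by (intro continuous_intros continuous_on_compose2[OF c_cont[of UNIV]]) auto
  have w_periodic: "w (t + 2 * pi) = w t" for t
    using c_periodic[of "u0 + t"] by (simp add: w_def add.assoc)
  have far: "- \<i> * w t \<notin> \<real>\<^sub>\<le>\<^sub>0" if t: "t \<in> ?K" for t
  proof
    assume "- \<i> * w t \<in> \<real>\<^sub>\<le>\<^sub>0"
    then have *: "Im (w t) \<le> 0" "Re (w t) = 0" by (auto simp: complex_nonpos_Reals_iff)
    have "2 * \<epsilon> \<le> norm (c (u0 + t) - c u0)" using t0(2)[OF t] by (simp add: \<epsilon>_def)
    also have "\<dots> = \<bar>Im (c (u0 + t) - c u0)\<bar>"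
      using *(2) by (simp add: w_def z_def cmod_def)
    also have "\<dots> \<le> \<epsilon>" using *(1) low[of "u0 + t"] by (simp add: w_def z_def)
    finally show False using \<epsilon> by simp
  qed
  have near: "\<i> * w t \<notin> \<real>\<^sub>\<le>\<^sub>0" if t: "t \<in> {- \<delta>..\<delta>}" for t
  proof
    assume "\<i> * w t \<in> \<real>\<^sub>\<le>\<^sub>0"
    then have *: "Im (w t) \<ge> 0" "Re (w t) = 0" by (auto simp: complex_nonpos_Reals_iff)
    have "t = 0"
      using Re_decreasing[of t 0] Re_decreasing[of 0 t] *(2) t by (cases t "0 :: real" rule: linorder_cases) (auto simp: w_def z_def)
    then show False using *(1) \<epsilon> by (simp add: w_def z_def)
  qed
  have w_nonzero: "w t \<noteq> 0" for t
  proof -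
    let ?s = "t + \<delta> + 2 * pi * of_int (- \<lfloor>(t + \<delta>) / (2 * pi)\<rfloor>)"
    have s: "0 \<le> ?s" "?s < 2 * pi"
      using floor_divide_lower[of "2 * pi" "t + \<delta>"] floor_divide_upper[of "2 * pi" "t + \<delta>"] by (auto simp: algebra_simps)
    have "w t = w (?s - \<delta>)"
      using c_periodic_int[of "u0 + t" "- \<lfloor>(t + \<delta>) / (2 * pi)\<rfloor>"] by (simp add: w_def algebra_simps)
    moreover have "w (?s - \<delta>) \<noteq> 0"
      using far[of "?s - \<delta>"] near[of "?s - \<delta>"] s by (cases "?s - \<delta> \<le> \<delta>") auto
    ultimately show ?thesis by simp
  qed
  obtain l where l: "continuous_on UNIV l" "\<And>t. w t = exp (l t)"
    using continuous_logarithm_on_contractible[OF w_cont[of UNIV] contractible_UNIV w_nonzero] by auto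
  have l_cont: "continuous_on S l" for S using continuous_on_subset[OF l(1)] by auto
  \<comment> \<open>a principal logarithm of \<open>r w\<close> differs from the continuous logarithm \<open>l\<close> of \<open>w\<close> by a constant, as long as it avoids its branch cut\<close>
  have turn: "l y - Ln (r * w y) = l x - Ln (r * w x)"
    if "r \<noteq> 0" "\<And>t. t \<in> S \<Longrightarrow> r * w t \<notin> \<real>\<^sub>\<le>\<^sub>0" "connected S" "x \<in> S" "y \<in> S" for r x y S
  proof (rule continuous_exp_lift_constant[of S "\<lambda>t. l t - Ln (r * w t)" "1 / r"])
    show "continuous_on S (\<lambda>t. l t - Ln (r * w t))"
      by (intro continuous_intros l_cont w_cont that(2))
    show "exp (l t - Ln (r * w t)) = 1 / r" for t
      using that(1) w_nonzero[of t] by (simp add: exp_diff l(2))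
  qed (use that in auto)
  \<comment> \<open>the change of the logarithm of \<open>w\<close> over one period that starts at the point \<open>- \<delta>\<close>\<close>
  define \<kappa> where "\<kappa> = l (2 * pi - \<delta>) - l (- \<delta>)"
  have "w (2 * pi - \<delta>) = w (- \<delta>)" using w_periodic[of "- \<delta>"] by simp
  moreover have "l (2 * pi - \<delta>) - Ln (- \<i> * w (2 * pi - \<delta>)) = l \<delta> - Ln (- \<i> * w \<delta>)"
    by (rule turn[of _ ?K]) (use far \<delta> in auto)
  ultimately have 1: "l (2 * pi - \<delta>) = l \<delta> - Ln (- \<i> * w \<delta>) + Ln (- \<i> * w (- \<delta>))"
    by (simp only: diff_eq_eq)
  have "l (- \<delta>) - Ln (\<i> * w (- \<delta>)) = l \<delta> - Ln (\<i> * w \<delta>)"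
    by (rule turn[of _ "{- \<delta>..\<delta>}"]) (use near \<delta> in auto)
  then have 2: "l (- \<delta>) = l \<delta> - Ln (\<i> * w \<delta>) + Ln (\<i> * w (- \<delta>))"
    by (simp only: diff_eq_eq)
  have "\<kappa> = (Ln (- \<i> * w (- \<delta>)) - Ln (\<i> * w (- \<delta>))) + (Ln (\<i> * w \<delta>) - Ln (- \<i> * w \<delta>))"
    unfolding \<kappa>_def 1 2 by simp
  moreover have "Re (w (- \<delta>)) > 0" "Re (w \<delta>) < 0"
    using Re_decreasing[of "- \<delta>" 0] Re_decreasing[of 0 \<delta>] \<delta> by (auto simp: w_def z_def)
  ultimately have Im_\<kappa>: "- 4 * pi < Im \<kappa>" "Im \<kappa> < 0"
    using Arg_lt_pi[of "\<i> * w (- \<delta>)"] Arg_lt_pi[of "- \<i> * w \<delta>"]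
      Arg_neg_iff[of "- \<i> * w (- \<delta>)"] Arg_neg_iff[of "\<i> * w \<delta>"]
      mpi_less_Arg[of "- \<i> * w (- \<delta>)"] mpi_less_Arg[of "\<i> * w \<delta>"] w_nonzero
    by (auto simp: Arg_def)
  have "exp \<kappa> = 1" using \<open>w (2 * pi - \<delta>) = w (- \<delta>)\<close> l(2) by (simp add: \<kappa>_def exp_diff)
  then obtain n :: int where n: "\<kappa> = (of_int (2 * n) * pi) * \<i>" using exp_eq[of \<kappa> 0] by auto
  have "of_int n * pi < 0 * pi" "(-2) * pi < of_int n * pi" using Im_\<kappa> by (simp_all add: n mult.commute)
  then have "real_of_int n < 0" "-2 < real_of_int n" by (simp_all only: mult_less_cancel_right_pos pi_gt_zero)
  then have "n = -1" by linarith
  then have \<kappa>: "\<kappa> = - (2 * of_real pi * \<i>)" by (simp add: n)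
  have z_notin: "z \<notin> range c"
  proof
    assume "z \<in> range c"
    then obtain u where "z = c u" by auto
    then show False using w_nonzero[of "u - u0"] by (simp add: w_def)
  qed
  obtain q where q: "path q" "pathfinish q - pathstart q = 2 * of_real pi * \<i> * winding_number circuit z"
      "\<And>t. t \<in> {0..1} \<Longrightarrow> circuit t = z + exp (q t)"
    using winding_number_as_continuous_log[OF path_circuit, of z] z_notin path_image_circuit by metis
  \<comment> \<open>Time 0 of \<open>w\<close> is the lowest point, while \<open>circuit\<close> starts at parameter 0 of \<open>c\<close>; hence the shift by \<open>u0\<close>.\<close>
  have "q 1 - l (2 * pi * 1 - u0) = q 0 - l (2 * pi * 0 - u0)"
  proof (rule continuous_exp_lift_constant[of "{0..1}" "\<lambda>x. q x - l (2 * pi * x - u0)" 1])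
    show "continuous_on {0..1} (\<lambda>x. q x - l (2 * pi * x - u0))"
      using q(1) unfolding path_def by (intro continuous_intros continuous_on_compose2[OF l(1)]) auto
    fix x :: real assume "x \<in> {0..1}"
    then have "exp (q x) = w (2 * pi * x - u0)" using q(3)[of x] by (simp add: w_def circuit_def algebra_simps)
    then show "exp (q x - l (2 * pi * x - u0)) = 1" by (simp add: exp_diff l(2))
  qed auto
  then have "q 1 - q 0 = l (2 * pi - u0) - l (- u0)" by (simp add: diff_eq_eq)
  moreover have "l (- u0 + 2 * pi) - l (- u0) = l (- \<delta> + 2 * pi) - l (- \<delta>)"
  proof (rule continuous_exp_lift_constant[of UNIV "\<lambda>t. l (t + 2 * pi) - l t" 1])
    show "continuous_on UNIV (\<lambda>t. l (t + 2 * pi) - l t)"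
      by (intro continuous_intros continuous_on_compose2[OF l(1)]) auto
    show "exp (l (t + 2 * pi) - l t) = 1" for t
      using w_periodic[of t] by (simp add: exp_diff flip: l(2)) (use w_nonzero in auto)
  qed auto
  then have "l (2 * pi - u0) - l (- u0) = \<kappa>" by (simp add: \<kappa>_def)
  ultimately have "pathfinish q - pathstart q = \<kappa>"
    by (simp add: pathfinish_def pathstart_def)
  then have "2 * of_real pi * \<i> * winding_number circuit z = 2 * of_real pi * \<i> * (- 1)"
    unfolding q(2) \<kappa> by simp
  then have "winding_number circuit z = - 1" by (rule mult_left_cancel[THEN iffD1, rotated]) simp
  then show thesis using that z_notin by blast
qed

text \<open>
  Hopf's Umlaufsatz. A leftward passage of the lowest point would produce a point with winding number
  \<open>-1\<close>; as this is not 0, the point would be enclosed by the curve.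
\<close>
theorem tangent_rotation:
  assumes ccw: "\<And>z. z \<in> inside (path_image circuit) \<Longrightarrow> winding_number circuit z = 1"
    and \<phi>: "continuous_on UNIV \<phi>" "\<And>u. sgn (c' u) = cis (\<phi> u)"
  shows "\<phi> (u + 2 * pi) = \<phi> u + 2 * pi"
proof -
  obtain u0 where low: "\<And>u. Im (c u0) \<le> Im (c u)" using lowest_point by blast
  have "\<not> Re (c' u0) < 0"
  proof
    assume "Re (c' u0) < 0"
    then obtain z where z: "z \<notin> range c" "winding_number circuit z = - 1"
      using winding_number_near_lowest_point_if_leftward low by blast
    have "pathfinish circuit = pathstart circuit"
      using c_periodic[of 0] by (simp add: pathfinish_def pathstart_def circuit_def)
    then have "z \<notin> outside (path_image circuit)"
      using winding_number_zero_in_outside[OF path_circuit, of z] z(2) by auto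
    then have "z \<in> inside (path_image circuit)"
      using z(1) inside_Un_outside[of "path_image circuit"] path_image_circuit by blast
    then show False using ccw z(2) by force
  qed
  moreover have "Re (c' u0) \<noteq> 0"
    using lowest_point_horizontal[OF low] c'_nonzero[of u0] by (auto simp: complex_eq_iff)
  ultimately show ?thesis using tangent_rotation_if_rightward[OF low _ \<phi>] by simp
qed

end

section \<open>The flow\<close>

definition to_complex :: "real ^ 2 \<Rightarrow> complex" where
  "to_complex x = Complex (x $ 1) (x $ 2)"

lemma bounded_linear_to_complex: "bounded_linear to_complex"
proof -
  have "linear to_complex"
    by (rule linearI) (simp_all add: to_complex_def complex_eq_iff)
  then show ?thesis by (simp add: linear_conv_bounded_linear)
qed

lemma to_complex_e_th: "to_complex (e_th x) = cis (x + pi / 2)"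
  by (simp add: to_complex_def e_th_def complex_eq_iff cos_add sin_add)

lemma to_complex_eq_iff: "to_complex x = to_complex y \<longleftrightarrow> x = y"
  by (simp add: to_complex_def vec_eq_iff forall_2)

lemma e_r_add_pi_half: "e_r (x + pi / 2) = e_th x"
  by (simp add: e_r_def e_th_def cos_add sin_add)

text \<open>
  Both parameters are reduced to one period, where the circle path is injective.
\<close>
lemma simple_closed_ccw_inj:
  assumes "simple_closed_ccw \<gamma>" "\<gamma> u = \<gamma> w"
  shows "\<exists>n::int. u = w + 2 * pi * of_int n"
proof -
  interpret periodic_fun_simple \<gamma> "2 * pi"
    using assms by unfold_locales (simp add: simple_closed_ccw_def)
  define x y where "x = frac (u / (2 * pi))" and "y = frac (w / (2 * pi))"
  have red: "\<gamma> (2 * pi * frac (z / (2 * pi))) = \<gamma> z" for z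
  proof -
    have "2 * pi * frac (z / (2 * pi)) = z - of_int \<lfloor>z / (2 * pi)\<rfloor> * (2 * pi)"
      by (simp add: frac_def algebra_simps)
    then show ?thesis by (simp only: minus_of_int)
  qed
  have "circle_path \<gamma> x = circle_path \<gamma> y"
    using assms(2) by (simp add: circle_path_def x_def y_def red)
  moreover have "x \<in> {0..<1}" "y \<in> {0..<1}" by (auto simp: x_def y_def frac_lt_1)
  moreover have "loop_free (circle_path \<gamma>)"
    using assms(1) by (simp add: simple_closed_ccw_def simple_path_def)
  ultimately have "x = y \<or> x = 0 \<and> y = 1 \<or> x = 1 \<and> y = 0"
    unfolding loop_free_def by (meson atLeastAtMost_iff atLeastLessThan_iff less_imp_le)
  then have "x = y" using \<open>x \<in> {0..<1}\<close> \<open>y \<in> {0..<1}\<close> by auto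
  then have "u / (2 * pi) - w / (2 * pi) = of_int (\<lfloor>u / (2 * pi)\<rfloor> - \<lfloor>w / (2 * pi)\<rfloor>)"
    by (simp add: x_def y_def frac_def)
  then have "u = w + 2 * pi * of_int (\<lfloor>u / (2 * pi)\<rfloor> - \<lfloor>w / (2 * pi)\<rfloor>)"
    by (simp add: field_simps)
  then show ?thesis by blast
qed

locale mink_flow = unit_ball P a for P a +
  fixes \<gamma> :: "real \<Rightarrow> real ^ 2" and T :: real and F :: "real \<Rightarrow> real \<Rightarrow> real ^ 2"
    and v \<theta> :: "real \<Rightarrow> real \<Rightarrow> real"
  assumes flow: "mink_curvature_flow a \<gamma> T F v \<theta>"
begin

abbreviation "I \<equiv> {0..<T}"
abbreviation "k \<equiv> mink_curvature a v \<theta>"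

text \<open>
  The area density of the unit ball with respect to the normal angle, up to the factor \<open>1 / 2\<close>.
\<close>
definition \<omega> :: "real \<Rightarrow> real" where
  "\<omega> x = bracket (p_curve a x) (p_curve' a x)"

lemma T_pos: "0 < T" and v_pos: "t \<in> I \<Longrightarrow> v u t > 0"
  and F_periodic: "t \<in> I \<Longrightarrow> F (u + 2 * pi) t = F u t"
  and F_direction: "t \<in> I \<Longrightarrow> F_u F u t = norm (F_u F u t) *\<^sub>R e_th (\<theta> u t)"
  and F_deriv_u: "t \<in> I \<Longrightarrow> ((\<lambda>w. F w t) has_vector_derivative v u t *\<^sub>R q_curve a (\<theta> u t)) (at u)"
  and F_deriv_t: "t \<in> I \<Longrightarrow> ((\<lambda>\<tau>. F u \<tau>) has_vector_derivative - k u t *\<^sub>R p_curve a (\<theta> u t)) (at t within I)"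
  and F_0: "F u 0 = \<gamma> u" and \<gamma>: "simple_closed_ccw \<gamma>"
  and F_smooth: "smooth_on (\<lambda>(u, t). F u t) (UNIV \<times> I)"
  and \<theta>_smooth: "smooth_on (\<lambda>(u, t). \<theta> u t) (UNIV \<times> I)"
  using flow unfolding mink_curvature_flow_def e_r_add_pi_half by blast+

text \<open>
  A point of a half-open interval is a limit point of it, so one-sided time derivatives are unique, also
  at the initial time.
\<close>
lemma F_t_unique:
  assumes t: "t \<in> I" and D: "((\<lambda>\<tau>. F u \<tau>) has_vector_derivative D) (at t within I)"
  shows "D = - k u t *\<^sub>R p_curve a (\<theta> u t)"
proof (rule vector_derivative_unique_within[OF _ D F_deriv_t[OF t]])
  show "at t within I \<noteq> bot" using t by (simp add: trivial_limit_within)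
qed

lemma F_u_eq: "t \<in> I \<Longrightarrow> F_u F u t = v u t *\<^sub>R q_curve a (\<theta> u t)"
  unfolding F_u_def by (rule vector_derivative_at[OF F_deriv_u])

lemma F_u_deriv: "t \<in> I \<Longrightarrow> ((\<lambda>w. F w t) has_vector_derivative F_u F u t) (at u)"
  using F_deriv_u by (simp add: F_u_eq)

lemma F_u_nonzero: "t \<in> I \<Longrightarrow> F_u F u t \<noteq> 0"
proof
  assume t: "t \<in> I" "F_u F u t = 0"
  have "bracket (e_r (\<theta> u t)) (F_u F u t) = 0" unfolding t(2) by (simp add: bracket_linear)
  then show False
    using v_pos[OF t(1), of u] a_pos[of "\<theta> u t"] by (simp add: F_u_eq[OF t(1)] q_curve_eq bracket_linear)
qed

lemma F_u_periodic: "t \<in> I \<Longrightarrow> F_u F (u + 2 * pi) t = F_u F u t"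
proof -
  assume t: "t \<in> I"
  have "(((\<lambda>w. F w t) \<circ> (\<lambda>u. u + 2 * pi)) has_vector_derivative 1 *\<^sub>R F_u F (u + 2 * pi) t) (at u)"
    by (rule vector_diff_chain_at) (auto intro!: derivative_eq_intros F_u_deriv t)
  then have "((\<lambda>w. F w t) has_vector_derivative F_u F (u + 2 * pi) t) (at u)" by (simp add: o_def F_periodic[OF t])
  then show ?thesis using F_u_deriv[OF t] vector_derivative_unique_at by blast
qed

lemma \<theta>_deriv_u: "t \<in> I \<Longrightarrow> ((\<lambda>w. \<theta> w t) has_real_derivative deriv (\<lambda>w. \<theta> w t) u) (at u)"
  and \<theta>_deriv_t: "t \<in> I \<Longrightarrow> \<exists>D. ((\<lambda>\<tau>. \<theta> u \<tau>) has_real_derivative D) (at t within I)"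
  and \<theta>_u_cont: "continuous_on (UNIV \<times> I) (\<lambda>(u, t). deriv (\<lambda>w. \<theta> w t) u)"
proof -
  have "Ck_on (Suc 0) (\<lambda>(u, t). \<theta> u t) (UNIV \<times> I)" using \<theta>_smooth unfolding smooth_on_def by blast
  then obtain \<theta>u \<theta>t where 1: "\<And>u t. t \<in> I \<Longrightarrow> ((\<lambda>w. \<theta> w t) has_vector_derivative \<theta>u u t) (at u)"
    "\<And>u t. t \<in> I \<Longrightarrow> ((\<lambda>\<tau>. \<theta> u \<tau>) has_vector_derivative \<theta>t u t) (at t within I)"
    "Ck_on 0 (\<lambda>(u, t). \<theta>u u t) (UNIV \<times> I)" "Ck_on 0 (\<lambda>(u, t). \<theta>t u t) (UNIV \<times> I)"
    by (erule Ck_on_Suc_partials)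
  have 2: "deriv (\<lambda>w. \<theta> w t) u = \<theta>u u t" if "t \<in> I" for u t
    using 1(1)[OF that] by (intro DERIV_imp_deriv) (simp add: has_real_derivative_iff_has_vector_derivative)
  have "continuous_on (UNIV \<times> I) (\<lambda>(u, t). deriv (\<lambda>w. \<theta> w t) u) \<longleftrightarrow> continuous_on (UNIV \<times> I) (\<lambda>(u, t). \<theta>u u t)"
    by (rule continuous_on_cong) (auto simp: 2)
  then show "continuous_on (UNIV \<times> I) (\<lambda>(u, t). deriv (\<lambda>w. \<theta> w t) u)" using 1(3) by simp
  show "((\<lambda>w. \<theta> w t) has_real_derivative deriv (\<lambda>w. \<theta> w t) u) (at u)" if "t \<in> I"
    using 1(1)[OF that] 2[OF that] by (simp add: has_real_derivative_iff_has_vector_derivative)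
  show "\<exists>D. ((\<lambda>\<tau>. \<theta> u \<tau>) has_real_derivative D) (at t within I)" if "t \<in> I"
    using 1(2)[OF that] unfolding has_real_derivative_iff_has_vector_derivative by (rule exI)
qed

definition F_tu :: "real \<Rightarrow> real \<Rightarrow> real ^ 2" where
  "F_tu u t = vector_derivative (\<lambda>w. - k w t *\<^sub>R p_curve a (\<theta> w t)) (at u)"

text \<open>
  Smoothness provides partial derivatives of \<open>F\<close> without naming them; by uniqueness they are the ones that
  the flow equations prescribe.
\<close>
lemma F_tu_deriv: "t \<in> I \<Longrightarrow> ((\<lambda>w. - k w t *\<^sub>R p_curve a (\<theta> w t)) has_vector_derivative F_tu u t) (at u)"
  and F_ut_eq_F_tu: "t \<in> I \<Longrightarrow> ((\<lambda>\<tau>. F_u F u \<tau>) has_vector_derivative F_tu u t) (at t within I)"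
  and F_u_cont: "continuous_on (UNIV \<times> I) (\<lambda>(u, t). F_u F u t)"
  and F_tu_cont: "continuous_on (UNIV \<times> I) (\<lambda>(u, t). F_tu u t)"
proof -
  have "Ck_on (Suc (Suc 0)) (\<lambda>(u, t). F u t) (UNIV \<times> I)" using F_smooth unfolding smooth_on_def by blast
  then obtain Fu Ft where 1: "\<And>u t. t \<in> I \<Longrightarrow> ((\<lambda>w. F w t) has_vector_derivative Fu u t) (at u)"
    "\<And>u t. t \<in> I \<Longrightarrow> ((\<lambda>\<tau>. F u \<tau>) has_vector_derivative Ft u t) (at t within I)"
    "Ck_on (Suc 0) (\<lambda>(u, t). Fu u t) (UNIV \<times> I)" "Ck_on (Suc 0) (\<lambda>(u, t). Ft u t) (UNIV \<times> I)"
    by (erule Ck_on_Suc_partials)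
  from 1(4) obtain Ftu Ftt where 2: "\<And>u t. t \<in> I \<Longrightarrow> ((\<lambda>w. Ft w t) has_vector_derivative Ftu u t) (at u)"
    "\<And>u t. t \<in> I \<Longrightarrow> ((\<lambda>\<tau>. Ft u \<tau>) has_vector_derivative Ftt u t) (at t within I)"
    "Ck_on 0 (\<lambda>(u, t). Ftu u t) (UNIV \<times> I)" "Ck_on 0 (\<lambda>(u, t). Ftt u t) (UNIV \<times> I)"
    by (erule Ck_on_Suc_partials)
  have Fu: "F_u F u t = Fu u t" if "t \<in> I" for u t
    unfolding F_u_def by (rule vector_derivative_at[OF 1(1)[OF that]])
  have Ft: "- k u t *\<^sub>R p_curve a (\<theta> u t) = Ft u t" if t: "t \<in> I" for u t
    by (rule F_t_unique[OF t 1(2)[OF t], symmetric])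
  have Ftu: "F_tu u t = Ftu u t" if t: "t \<in> I" for u t
    unfolding F_tu_def Ft[OF t] by (rule vector_derivative_at[OF 2(1)[OF t]])
  show "((\<lambda>w. - k w t *\<^sub>R p_curve a (\<theta> w t)) has_vector_derivative F_tu u t) (at u)" if t: "t \<in> I"
    using 2(1)[OF t] by (simp only: Ft[OF t] Ftu[OF t])
  show "((\<lambda>\<tau>. F_u F u \<tau>) has_vector_derivative F_tu u t) (at t within I)" if t: "t \<in> I"
    unfolding Ftu[OF t]
    by (rule mixed_partials[OF F_u_deriv 1(2) 2(1) Ck_on_imp_continuous_on[OF 1(4)]
          Ck_on_imp_continuous_on[OF 2(3)] t])
  have "continuous_on (UNIV \<times> I) (\<lambda>(u, t). F_u F u t) \<longleftrightarrow> continuous_on (UNIV \<times> I) (\<lambda>(u, t). Fu u t)"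
    by (rule continuous_on_cong) (auto simp: Fu)
  then show "continuous_on (UNIV \<times> I) (\<lambda>(u, t). F_u F u t)"
    using Ck_on_imp_continuous_on[OF 1(3)] by simp
  have "continuous_on (UNIV \<times> I) (\<lambda>(u, t). F_tu u t) \<longleftrightarrow> continuous_on (UNIV \<times> I) (\<lambda>(u, t). Ftu u t)"
    by (rule continuous_on_cong) (auto simp: Ftu)
  then show "continuous_on (UNIV \<times> I) (\<lambda>(u, t). F_tu u t)" using 2(3) by simp
qed

lemma \<omega>_cont: "continuous_on S \<omega>"
  unfolding \<omega>_def[abs_def] bracket_p_p'
  by (intro continuous_intros continuous_on_subset[OF a_cont] continuous_on_subset[OF a_cont2] subset_UNIV)

text \<open>
  The speed as a bracket of differentiable quantities, by \<open>[p, q] = 1\<close>; both its regularity and its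
  evolution are read off from this formula.
\<close>
lemma v_eq: "t \<in> I \<Longrightarrow> v u t = bracket (p_curve a (\<theta> u t)) (F_u F u t)"
  using a_pos[of "\<theta> u t"] by (simp add: F_u_eq q_curve_eq p_curve_def bracket_linear)

lemma k_v: "t \<in> I \<Longrightarrow> k u t * v u t = \<omega> (\<theta> u t) * deriv (\<lambda>w. \<theta> w t) u"
  using v_pos[of t u] by (simp add: mink_curvature_def \<omega>_def)

lemma \<theta>_cont: "continuous_on (UNIV \<times> I) (\<lambda>(u, t). \<theta> u t)"
  using \<theta>_smooth by (auto simp: smooth_on_def intro: Ck_on_imp_continuous_on)

lemma v_cont: "continuous_on (UNIV \<times> I) (\<lambda>(u, t). v u t)"
proof -
  have "continuous_on (UNIV \<times> I) (\<lambda>x. bracket (p_curve a ((\<lambda>(u, t). \<theta> u t) x)) ((\<lambda>(u, t). F_u F u t) x))"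
    by (intro continuous_on_bracket continuous_on_compose2[OF p_cont[of UNIV]] \<theta>_cont F_u_cont) auto
  also have "?this \<longleftrightarrow> ?thesis" by (rule continuous_on_cong) (auto simp: v_eq)
  finally show ?thesis .
qed

lemma k_cont: "continuous_on (UNIV \<times> I) (\<lambda>(u, t). k u t)"
proof -
  have "\<forall>x \<in> UNIV \<times> I. (\<lambda>(u, t). v u t) x \<noteq> 0"
    using v_pos by (metis (no_types, lifting) SigmaE case_prod_conv less_irrefl)
  then have "continuous_on (UNIV \<times> I) (\<lambda>x. \<omega> ((\<lambda>(u, t). \<theta> u t) x) * ((\<lambda>(u, t). deriv (\<lambda>w. \<theta> w t) u) x / (\<lambda>(u, t). v u t) x))"
    by (intro continuous_intros continuous_on_compose2[OF \<omega>_cont[of UNIV]] \<theta>_cont v_cont \<theta>_u_cont) auto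
  then show ?thesis by (simp add: case_prod_unfold mink_curvature_def \<omega>_def)
qed

text \<open>
  In the time derivative of \<open>v = [p, F\<^sub>u]\<close> the derivative of \<open>p\<close> is parallel to \<open>F\<^sub>u\<close> and drops out.
  The remaining \<open>[p, F\<^sub>t\<^sub>u]\<close> is found without differentiating the curvature: \<open>F\<^sub>t\<close> is parallel to \<open>p\<close>
  all along the curve, so the derivative of \<open>[F\<^sub>t, p]\<close> in \<open>u\<close> vanishes.
\<close>
lemma v_deriv_t:
  assumes t: "t \<in> I"
  shows "((\<lambda>\<tau>. v u \<tau>) has_real_derivative - (k u t)\<^sup>2 * v u t) (at t within I)"
proof -
  obtain D where D: "((\<lambda>\<tau>. \<theta> u \<tau>) has_real_derivative D) (at t within I)"
    using \<theta>_deriv_t[OF t] by blast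
  define \<theta>' where "\<theta>' = deriv (\<lambda>w. \<theta> w t) u"
  define p p' where "p = p_curve a (\<theta> u t)" and "p' = p_curve' a (\<theta> u t)"
  have p_deriv: "(p_curve a has_vector_derivative p_curve' a x) (at x within S)" for x S
    unfolding p_curve'_eq by (rule p_has_vector_derivative)
  have p_t: "((\<lambda>\<tau>. p_curve a (\<theta> u \<tau>)) has_vector_derivative D *\<^sub>R p') (at t within I)"
    using vector_diff_chain_within[OF D[unfolded has_real_derivative_iff_has_vector_derivative] p_deriv]
    by (simp add: o_def p'_def)
  have p_u: "((\<lambda>w. p_curve a (\<theta> w t)) has_vector_derivative \<theta>' *\<^sub>R p') (at u)"
    using vector_diff_chain_at[OF \<theta>_deriv_u[OF t, of u, unfolded has_real_derivative_iff_has_vector_derivative] p_deriv]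
    by (simp add: o_def p'_def \<theta>'_def)
  have "((\<lambda>w. bracket (- k w t *\<^sub>R p_curve a (\<theta> w t)) (p_curve a (\<theta> w t))) has_vector_derivative
      bracket (- k u t *\<^sub>R p) (\<theta>' *\<^sub>R p') + bracket (F_tu u t) p) (at u)"
    unfolding p_def by (rule has_vector_derivative_bracket[OF F_tu_deriv[OF t] p_u])
  moreover have "(\<lambda>w. bracket (- k w t *\<^sub>R p_curve a (\<theta> w t)) (p_curve a (\<theta> w t))) = (\<lambda>w. 0)"
    by (simp add: bracket_linear)
  ultimately have "bracket (- k u t *\<^sub>R p) (\<theta>' *\<^sub>R p') + bracket (F_tu u t) p = 0"
    using vector_derivative_unique_at[OF _ has_vector_derivative_const] by metis
  then have "bracket p (F_tu u t) = - k u t * (\<omega> (\<theta> u t) * \<theta>')"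
    using bracket_swap[of "F_tu u t" p] by (simp add: bracket_linear \<omega>_def p_def p'_def algebra_simps)
  also have "\<dots> = - (k u t)\<^sup>2 * v u t" by (simp add: k_v[OF t, symmetric] \<theta>'_def power2_eq_square)
  finally have main: "bracket p (F_tu u t) = - (k u t)\<^sup>2 * v u t" .
  have "((\<lambda>\<tau>. bracket (p_curve a (\<theta> u \<tau>)) (F_u F u \<tau>)) has_vector_derivative
      bracket p (F_tu u t) + bracket (D *\<^sub>R p') (F_u F u t)) (at t within I)"
    unfolding p_def by (rule has_vector_derivative_bracket[OF p_t F_ut_eq_F_tu[OF t]])
  moreover have "bracket (D *\<^sub>R p') (F_u F u t) = 0"
    by (simp add: p'_def F_u_eq[OF t] p_curve'_eq q_curve_eq bracket_linear)
  ultimately have "((\<lambda>\<tau>. bracket (p_curve a (\<theta> u \<tau>)) (F_u F u \<tau>)) has_vector_derivative - (k u t)\<^sup>2 * v u t) (at t within I)"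
    by (simp add: main)
  then have "((\<lambda>\<tau>. v u \<tau>) has_vector_derivative - (k u t)\<^sup>2 * v u t) (at t within I)"
    by (rule has_vector_derivative_transform[rotated 2]) (use t v_eq in auto)
  then show ?thesis by (simp add: has_real_derivative_iff_has_vector_derivative)
qed

lemma slice_cont:
  assumes "continuous_on (UNIV \<times> I) (\<lambda>(u, t). g u t)" "t \<in> I"
  shows "continuous_on J (\<lambda>u. g u t)"
proof -
  have "continuous_on J (\<lambda>u. (\<lambda>(u, t). g u t) (u, t))"
    by (rule continuous_on_compose2[OF assms(1)]) (use assms(2) in \<open>auto intro!: continuous_intros\<close>)
  then show ?thesis by simp
qed

lemma has_derivative_integral_circle:
  fixes g g' :: "real \<Rightarrow> real \<Rightarrow> real"
  assumes g: "\<And>u t. t \<in> I \<Longrightarrow> ((\<lambda>\<tau>. g u \<tau>) has_real_derivative g' u t) (at t within I)"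
    and cont: "continuous_on (UNIV \<times> I) (\<lambda>(u, t). g u t)" "continuous_on (UNIV \<times> I) (\<lambda>(u, t). g' u t)"
    and t: "t \<in> I"
  shows "((\<lambda>\<tau>. integral {0..2 * pi} (\<lambda>u. g u \<tau>)) has_real_derivative integral {0..2 * pi} (\<lambda>u. g' u t)) (at t within I)"
proof -
  have "((\<lambda>\<tau>. integral (cbox 0 (2 * pi)) (\<lambda>u. g u \<tau>)) has_real_derivative
      integral (cbox 0 (2 * pi)) (\<lambda>u. g' u t)) (at t within I)"
  proof (rule leibniz_rule_field_derivative)
    show "(\<lambda>u. g u \<tau>) integrable_on cbox 0 (2 * pi)" if "\<tau> \<in> I" for \<tau>
      by (intro integrable_continuous slice_cont[OF cont(1) that])
    have "continuous_on (I \<times> cbox 0 (2 * pi)) (\<lambda>x. (\<lambda>(u, t). g' u t) (snd x, fst x))"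
      by (rule continuous_on_compose2[OF cont(2)]) (auto intro!: continuous_intros)
    then show "continuous_on (I \<times> cbox 0 (2 * pi)) (\<lambda>(\<tau>, u). g' u \<tau>)" by (simp add: case_prod_unfold)
  qed (use g t in auto)
  then show ?thesis by simp
qed

theorem length_derivative:
  assumes t: "t \<in> I"
  shows "(Q_length v has_real_derivative
            - integral {0..Q_length v t} (\<lambda>s. (mink_curvature_arc a v \<theta> s t)\<^sup>2)) (at t within I)"
proof -
  have cont: "continuous_on (UNIV \<times> I) (\<lambda>(u, t). - (k u t)\<^sup>2 * v u t)"
    using k_cont v_cont by (auto intro!: continuous_intros simp: case_prod_unfold)
  have "(Q_length v has_real_derivative integral {0..2 * pi} (\<lambda>u. - (k u t)\<^sup>2 * v u t)) (at t within I)"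
    unfolding Q_length_def[abs_def]
    by (rule has_derivative_integral_circle[OF v_deriv_t v_cont cont t])
  moreover have "integral {0..integral {0..2 * pi} (\<lambda>u. v u t)}
       (\<lambda>s. (k (the_inv_into {0..2 * pi} (\<lambda>u. integral {0..u} (\<lambda>w. v w t)) s) t)\<^sup>2)
     = integral {0..2 * pi} (\<lambda>u. v u t * (k u t)\<^sup>2)"
    by (rule integral_arclength_reparametrization[of "2 * pi" "\<lambda>u. v u t" "\<lambda>u. (k u t)\<^sup>2"])
       (use slice_cont[OF v_cont t] slice_cont[OF k_cont t] v_pos[OF t] in \<open>auto intro!: continuous_intros\<close>)
  then have "integral {0..Q_length v t} (\<lambda>s. (mink_curvature_arc a v \<theta> s t)\<^sup>2) = integral {0..2 * pi} (\<lambda>u. v u t * (k u t)\<^sup>2)"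
    unfolding Q_length_def mink_curvature_arc_def Q_arclength_def[abs_def] .
  ultimately show ?thesis by (simp add: mult.commute)
qed

text \<open>
  The tangent direction is periodic, so the increment of \<open>\<theta>\<close> is a multiple of \<open>2 \<pi>\<close>; being continuous in
  time it keeps its initial value, to which the Umlaufsatz applies.
\<close>
lemma tangent_angle_turns_once:
  assumes t: "t \<in> I"
  shows "\<theta> (2 * pi) t = \<theta> 0 t + 2 * pi"
proof -
  have 0: "0 \<in> I" using T_pos by simp
  have cis: "cis (\<theta> (2 * pi) \<tau> - \<theta> 0 \<tau>) = 1" if \<tau>: "\<tau> \<in> I" for \<tau>
  proof -
    have "norm (F_u F 0 \<tau>) *\<^sub>R e_th (\<theta> (2 * pi) \<tau>) = norm (F_u F 0 \<tau>) *\<^sub>R e_th (\<theta> 0 \<tau>)"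
      using F_u_periodic[OF \<tau>, of 0] F_direction[OF \<tau>, of "2 * pi"] F_direction[OF \<tau>, of 0] by simp
    then have "e_th (\<theta> (2 * pi) \<tau>) = e_th (\<theta> 0 \<tau>)" using F_u_nonzero[OF \<tau>, of 0] by simp
    then have "cis (\<theta> (2 * pi) \<tau>) = cis (\<theta> 0 \<tau>)" by (simp add: e_th_def complex_eq_iff vec_eq_iff forall_2)
    then show ?thesis by (simp flip: cis_divide)
  qed
  have slice: "continuous_on I (\<lambda>\<tau>. \<theta> u \<tau>)" for u
  proof -
    have "continuous_on I (\<lambda>\<tau>. (\<lambda>(u, t). \<theta> u t) (u, \<tau>))"
      by (rule continuous_on_compose2[OF \<theta>_cont]) (auto intro!: continuous_intros)
    then show ?thesis by simp
  qed
  have "\<theta> (2 * pi) t - \<theta> 0 t = \<theta> (2 * pi) 0 - \<theta> 0 0"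
    by (rule continuous_cis_lift_constant[of I "\<lambda>\<tau>. \<theta> (2 * pi) \<tau> - \<theta> 0 \<tau>" 1])
       (use cis t 0 in \<open>auto intro!: continuous_intros slice\<close>)
  define c where "c u = to_complex (F u 0)" for u
  define c' where "c' u = to_complex (F_u F u 0)" for u
  interpret simple_regular_closed_curve c c'
  proof
    show "(c has_vector_derivative c' u) (at u)" for u
      unfolding c_def[abs_def] c'_def by (rule bounded_linear.has_vector_derivative[OF bounded_linear_to_complex F_u_deriv[OF 0]])
    have "continuous_on UNIV (\<lambda>u. F_u F u 0)"
      by (rule slice_cont[OF F_u_cont 0])
    then show "continuous_on UNIV c'"
      unfolding c'_def[abs_def] by (rule bounded_linear.continuous_on[OF bounded_linear_to_complex])
    show "c' u \<noteq> 0" for u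
      using F_u_nonzero[OF 0, of u] by (auto simp: c'_def to_complex_def complex_eq_iff vec_eq_iff forall_2)
    show "c (u + 2 * pi) = c u" for u by (simp add: c_def F_periodic[OF 0])
    show "\<exists>n::int. u = w + 2 * pi * of_int n" if "c u = c w" for u w
      using that simple_closed_ccw_inj[OF \<gamma>] by (simp add: c_def to_complex_eq_iff F_0)
  qed
  have circuit: "circuit = circle_path \<gamma>"
    by (simp add: fun_eq_iff circuit_def c_def circle_path_def to_complex_def F_0)
  have "\<theta> (0 + 2 * pi) 0 + pi / 2 = \<theta> 0 0 + pi / 2 + 2 * pi"
  proof (rule tangent_rotation[where \<phi> = "\<lambda>u. \<theta> u 0 + pi / 2"])
    show "winding_number circuit z = 1" if "z \<in> inside (path_image circuit)" for z
      using \<gamma> that by (simp add: circuit simple_closed_ccw_def)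
    show "continuous_on UNIV (\<lambda>u. \<theta> u 0 + pi / 2)"
      by (intro continuous_intros slice_cont[OF \<theta>_cont 0])
    fix u
    have "c' u = of_real (norm (F_u F u 0)) * cis (\<theta> u 0 + pi / 2)"
      unfolding c'_def by (subst F_direction[OF 0])
        (simp only: linear_scale[OF bounded_linear.linear[OF bounded_linear_to_complex]] to_complex_e_th scaleR_conv_of_real[where 'a = complex])
    then show "sgn (c' u) = cis (\<theta> u 0 + pi / 2)"
      using F_u_nonzero[OF 0, of u] by (simp add: sgn_mult sgn_of_real sgn_cis)
  qed
  then show ?thesis using \<open>\<theta> (2 * pi) t - \<theta> 0 t = \<theta> (2 * pi) 0 - \<theta> 0 0\<close> by simp
qed

text \<open>
  The derivative of the integrand is \<open>[F, F\<^sub>t\<^sub>u] + [F\<^sub>t, F\<^sub>u]\<close>, which differs from \<open>2 [F\<^sub>t, F\<^sub>u]\<close> by the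
  derivative of the periodic function \<open>[F, F\<^sub>t]\<close> in \<open>u\<close>.
\<close>
theorem area_derivative:
  assumes t: "t \<in> I"
  shows "(enclosed_area F has_real_derivative - 2 * measure lebesgue P) (at t within I)"
proof -
  define Ft where "Ft u t = - k u t *\<^sub>R p_curve a (\<theta> u t)" for u t
  have F_cont: "continuous_on (UNIV \<times> I) (\<lambda>(u, t). F u t)"
    using F_smooth by (auto simp: smooth_on_def intro: Ck_on_imp_continuous_on)
  have Ft_cont: "continuous_on (UNIV \<times> I) (\<lambda>(u, t). Ft u t)"
  proof -
    have "continuous_on (UNIV \<times> I) (\<lambda>x. - (\<lambda>(u, t). k u t) x *\<^sub>R p_curve a ((\<lambda>(u, t). \<theta> u t) x))"
      by (intro continuous_intros k_cont continuous_on_compose2[OF p_cont[of UNIV]] \<theta>_cont) auto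
    then show ?thesis by (simp add: Ft_def case_prod_unfold)
  qed
  have Ft_F_u: "bracket (Ft u t) (F_u F u t) = - (\<omega> (\<theta> u t) * deriv (\<lambda>w. \<theta> w t) u)" for u
    by (simp add: Ft_def bracket_linear v_eq[OF t, symmetric] flip: k_v[OF t])
  let ?g = "\<lambda>u t. bracket (F u t) (F_u F u t)" and ?g' = "\<lambda>u t. bracket (F u t) (F_tu u t) + bracket (Ft u t) (F_u F u t)"
  have deriv: "((\<lambda>\<tau>. integral {0..2 * pi} (\<lambda>u. ?g u \<tau>)) has_real_derivative integral {0..2 * pi} (\<lambda>u. ?g' u t)) (at t within I)"
  proof (rule has_derivative_integral_circle[OF _ _ _ t])
    show "((\<lambda>\<tau>. ?g u \<tau>) has_real_derivative ?g' u t) (at t within I)" if "t \<in> I" for u t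
      unfolding has_real_derivative_iff_has_vector_derivative Ft_def
      by (rule has_vector_derivative_bracket[OF F_deriv_t[OF that] F_ut_eq_F_tu[OF that]])
    show "continuous_on (UNIV \<times> I) (\<lambda>(u, t). ?g u t)" "continuous_on (UNIV \<times> I) (\<lambda>(u, t). ?g' u t)"
      using F_cont Ft_cont F_u_cont F_tu_cont
      by (auto intro!: continuous_on_add continuous_on_bracket simp: case_prod_unfold)
  qed
  have "((\<lambda>u. bracket (F u t) (F_tu u t) + bracket (F_u F u t) (Ft u t)) has_integral
      bracket (F (2 * pi) t) (Ft (2 * pi) t) - bracket (F 0 t) (Ft 0 t)) {0..2 * pi}"
    unfolding Ft_def
    by (intro fundamental_theorem_of_calculus has_vector_derivative_bracket
        has_vector_derivative_at_within[OF F_u_deriv[OF t]] has_vector_derivative_at_within[OF F_tu_deriv[OF t]]) simp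
  moreover have "Ft (2 * pi) t = Ft 0 t"
  proof -
    have "((\<lambda>\<tau>. F 0 \<tau>) has_vector_derivative Ft (2 * pi) t) (at t within I)"
      using F_deriv_t[OF t, of "2 * pi"] unfolding Ft_def
      by (rule has_vector_derivative_transform[rotated 2]) (use t F_periodic[of _ 0] in auto)
    from F_t_unique[OF t this] show ?thesis by (simp add: Ft_def)
  qed
  ultimately have 1: "((\<lambda>u. bracket (F u t) (F_tu u t) + bracket (F_u F u t) (Ft u t)) has_integral 0) {0..2 * pi}"
    using F_periodic[OF t, of 0] by simp
  have 2: "((\<lambda>u. \<omega> (\<theta> u t) * deriv (\<lambda>w. \<theta> w t) u) has_integral integral {0..2 * pi} \<omega>) {0..2 * pi}"
  proof (rule integral_along_circle_map)
    show "\<omega> (x + 2 * pi) = \<omega> x" for x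
      unfolding \<omega>_def bracket_p_p' by (simp add: a_periodic deriv2_a_periodic)
  qed (use \<omega>_cont \<theta>_deriv_u[OF t] tangent_angle_turns_once[OF t] in auto)
  have "((\<lambda>u. ?g' u t) has_integral 0 + - 2 * integral {0..2 * pi} \<omega>) {0..2 * pi}"
    using has_integral_add[OF 1 has_integral_mult_right[OF 2, of "- 2"]]
    by (rule has_integral_eq[rotated]) (simp add: bracket_swap[of "F_u F _ t"] Ft_F_u)
  then have "integral {0..2 * pi} (\<lambda>u. ?g' u t) = - 4 * measure lebesgue P"
    by (simp add: integral_unique measure_unit_ball \<omega>_def[abs_def])
  with DERIV_cmult[OF deriv, of "1 / 2"] show ?thesis
    unfolding enclosed_area_def[abs_def] by simp
qed

end

theorem lemma4p2:
  fixes P :: "(real ^ 2) set" and a :: "real \<Rightarrow> real" and \<gamma> :: "real \<Rightarrow> real ^ 2"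
    and T :: real and F :: "real \<Rightarrow> real \<Rightarrow> real ^ 2" and v \<theta> :: "real \<Rightarrow> real \<Rightarrow> real" and t :: real
  assumes "smooth_unit_ball P a"
    and "mink_curvature_flow a \<gamma> T F v \<theta>"
    and "t \<in> {0..<T}"
  shows "(Q_length v has_real_derivative
            - integral {0..Q_length v t} (\<lambda>s. (mink_curvature_arc a v \<theta> s t)\<^sup>2))
          (at t within {0..<T}) \<and>
         (enclosed_area F has_real_derivative - 2 * measure lebesgue P) (at t within {0..<T})"
proof -
  interpret mink_flow P a \<gamma> T F v \<theta>
    using assms by unfold_locales
  show ?thesis using length_derivative area_derivative assms(3) by blast
qed

end
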